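(* Let $N\in\mathbb{N}$ and $p\in\mathbb{R}$ with $1<p\le N$, and for $0<R<\overline{R}$ let $\lambda_k(R,\overline{R})$, $q_{R,\overline{R}}$, $\bar q_-(R,\overline{R})$, $\bar q_+(R,\overline{R})$ and $\pi_p$ be as defined in the context. (i) Suppose that $N=p$. Then $$\lim_{R\to+\infty}\bar q_+(R,R+1)=\lim_{R\to+\infty}\bar q_-(R,R+1)=1.$$ In particular, for every integer $k\ge 1$, $$\lim_{R\to+\infty}\lambda_k(R,R+1)=(k\pi_p)^p,$$ that is, the eigenvalues $\lambda_k(R,R+1)$ converge, as $R\to+\infty$, to the eigenvalues of the problem $$(|v'(t)|^{p-2}v'(t))'+\lambda\,|v(t)|^{p-2}v(t)=0\ \text{ in }(0,1),\qquad v(0)=v(1)=0.$$ (ii) Suppose that $p=2$ and $N\ge 3$. Then $$\lim_{R\to+\infty}\bar q_+(R,R+1)=\lim_{R\to+\infty}\bar q_-(R,R+1)=1.$$ In particular, for every integer $k\ge 1$, $$\lim_{R\to+\infty}\lambda_k(R,R+1)=(k\pi)^2,$$ that is, the eigenvalues $\lambda_k(R,R+1)$ converge, as $R\to+\infty$, to the eigenvalues of the problem $$v''(t)+\lambda\,v(t)=0\ \text{ in }(0,1),\qquad v(0)=v(1)=0.$$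
   Context: Let $N\in\mathbb{N}$ be the space dimension, $1<p\le N$, and $0<R<\overline{R}$. Let $\Omega_{R,\overline{R}}=\{x\in\mathbb{R}^N: R<|x|<\overline{R}\}$. The number $\lambda_k=\lambda_k(R,\overline{R})$, $k\ge 1$, denotes the $k$-th radial eigenvalue of the Dirichlet problem $-\Delta_p u=\lambda|u|^{p-2}u$ in $\Omega_{R,\overline{R}}$, $u=0$ on $\partial\Omega_{R,\overline{R}}$, where $\Delta_p u=\operatorname{div}(|\nabla u|^{p-2}\nabla u)$. Equivalently, it is the $k$-th eigenvalue of the one-dimensional problem $$(r^{N-1}|u'(r)|^{p-2}u'(r))'+\lambda\,r^{N-1}|u(r)|^{p-2}u(r)=0\ \text{ in }(R,\overline{R}),\qquad u(R)=u(\overline{R})=0,$$ which is also (by a change of variables) the $k$-th eigenvalue of $$(|v'(t)|^{p-2}v'(t))'+\lambda\,q_{R,\overline{R}}(t)|v(t)|^{p-2}v(t)=0\ \text{ in }(0,1),\qquad v(0)=v(1)=0.$$ Here an eigenvalue is a $\lambda$ for which a nontrivial solution exists; the eigenvalues form a sequence $0<\lambda_1<\lambda_2<\cdots$ with $\lambda_k\to\infty$, and they are counted in this increasing order. The expression $|s|^{p-2}s$ is understood as $0$ at $s=0$. The weight $q_{R,\overline{R}}:[0,1]\to(0,\infty)$ is defined as follows. If $N>p$, $$q_{R,\overline{R}}(t)=\left(\frac{p-1}{N-p}\right)^{p}\frac{A^{\frac{(p-1)p}{N-p}}}{(B-t)^{\frac{p(N-1)}{N-p}}},\quad A=\frac{(R\overline{R})^{\frac{N-p}{p-1}}}{\overline{R}^{\frac{N-p}{p-1}}-R^{\frac{N-p}{p-1}}},\quad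 B=\frac{\overline{R}^{\frac{N-p}{p-1}}}{\overline{R}^{\frac{N-p}{p-1}}-R^{\frac{N-p}{p-1}}}.$$ If $N=p$, $$q_{R,\overline{R}}(t)=\left[R\left(\frac{\overline{R}}{R}\right)^t\ln\frac{\overline{R}}{R}\right]^{p}.$$ Moreover, $$\bar q_-(R,\overline{R})=\int_0^1\min\{1,q_{R,\overline{R}}(t)\}\,dt,\qquad \bar q_+(R,\overline{R})=\int_0^1\max\{1,q_{R,\overline{R}}(t)\}\,dt,$$ and $$\pi_p=\frac{2\pi(p-1)^{1/p}}{p\sin(\pi/p)}.$$ *)

theory Defs
  imports "HOL-Analysis.Analysis"
begin

text \<open>
  The map \<open>x \<mapsto> |x|\<^sup>p\<^sup>-\<^sup>2 x\<close>, for numbers and for vectors. Since \<open>*\<^sub>R\<close> is applied to \<open>x\<close> itself,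
  the value at \<open>x = 0\<close> is \<open>0\<close> for every \<open>p\<close>.
\<close>
definition phi :: "real \<Rightarrow> 'v::real_normed_vector \<Rightarrow> 'v" where
  "phi p x = (norm x powr (p - 2)) *\<^sub>R x"

definition annulus :: "real \<Rightarrow> real \<Rightarrow> (real ^ 'n::finite) set" where
  "annulus R Rb = {x. R < norm x \<and> norm x < Rb}"

definition has_divergence ::
  "(real ^ 'n \<Rightarrow> real ^ 'n) \<Rightarrow> real \<Rightarrow> real ^ 'n::finite \<Rightarrow> bool" where
  "has_divergence F d x \<longleftrightarrow>
     (\<exists>D. (F has_derivative D) (at x) \<and> d = (\<Sum>i\<in>UNIV. D (axis i 1) $ i))"

text \<open>
  \<open>u\<close> is a nontrivial radial solution of \<open>- \<Delta>\<^sub>p u = \<lambda> |u|\<^sup>p\<^sup>-\<^sup>2 u\<close> in the annulus with \<open>u = 0\<close> on its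
  boundary. The equation is read pointwise: \<open>u\<close> and the field \<open>|\<nabla>u|\<^sup>p\<^sup>-\<^sup>2 \<nabla>u\<close> (but not
  necessarily \<open>\<nabla>u\<close>, which may fail to be differentiable where it vanishes) are differentiable
  in the annulus. For radial \<open>u\<close> this is the radial ordinary differential equation for the
  profile of \<open>u\<close>, and no generality is lost with respect to weak solutions, because the annulus
  stays away from the origin.
\<close>
definition radial_eigenfunction ::
  "real \<Rightarrow> real \<Rightarrow> real \<Rightarrow> real \<Rightarrow> (real ^ 'n::finite \<Rightarrow> real) \<Rightarrow> bool" where
  "radial_eigenfunction p R Rb l u \<longleftrightarrow>
     (\<exists>w. \<forall>x\<in>closure (annulus R Rb). u x = w (norm x)) \<and>
     continuous_on (closure (annulus R Rb)) u \<and>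
     (\<forall>x\<in>frontier (annulus R Rb). u x = 0) \<and>
     (\<exists>x\<in>annulus R Rb. u x \<noteq> 0) \<and>
     (\<exists>g. \<forall>x\<in>annulus R Rb.
        (GDERIV u x :> g x) \<and>
        (\<exists>d. has_divergence (\<lambda>y. phi p (g y)) d x \<and> - d = l * phi p (u x)))"

definition radial_eigenvalues ::
  "'n::finite itself \<Rightarrow> real \<Rightarrow> real \<Rightarrow> real \<Rightarrow> real set" where
  "radial_eigenvalues _ p R Rb =
     {l. \<exists>u :: real ^ 'n \<Rightarrow> real. radial_eigenfunction p R Rb l u}"

text \<open>The \<open>k\<close>-th element of \<open>S\<close> in increasing order, counted from \<open>k = 1\<close>.\<close>
definition kth_smallest :: "real set \<Rightarrow> nat \<Rightarrow> real" where
  "kth_smallest S k =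
     (THE x. x \<in> S \<and> finite {y \<in> S. y < x} \<and> card {y \<in> S. y < x} + 1 = k)"

definition radial_eigenvalue ::
  "'n::finite itself \<Rightarrow> real \<Rightarrow> real \<Rightarrow> real \<Rightarrow> nat \<Rightarrow> real" where
  "radial_eigenvalue N p R Rb k = kth_smallest (radial_eigenvalues N p R Rb) k"

text \<open>Eigenvalues of \<open>(|v'|\<^sup>p\<^sup>-\<^sup>2 v')' + \<lambda> |v|\<^sup>p\<^sup>-\<^sup>2 v = 0\<close> in \<open>(0,1)\<close>, \<open>v(0) = v(1) = 0\<close>.\<close>
definition p_interval_eigenvalues :: "real \<Rightarrow> real set" where
  "p_interval_eigenvalues p =
     {l. \<exists>v v' :: real \<Rightarrow> real.
        continuous_on {0..1} v \<and> v 0 = 0 \<and> v 1 = 0 \<and> (\<exists>t\<in>{0<..<1}. v t \<noteq> 0) \<and>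
        (\<forall>t\<in>{0<..<1}.
           (v has_real_derivative v' t) (at t) \<and>
           (\<exists>d. ((\<lambda>s. phi p (v' s)) has_real_derivative d) (at t) \<and>
                d + l * phi p (v t) = 0))}"

text \<open>Eigenvalues of \<open>v'' + \<lambda> v = 0\<close> in \<open>(0,1)\<close>, \<open>v(0) = v(1) = 0\<close>.\<close>
definition interval_eigenvalues :: "real set" where
  "interval_eigenvalues =
     {l. \<exists>v v' :: real \<Rightarrow> real.
        continuous_on {0..1} v \<and> v 0 = 0 \<and> v 1 = 0 \<and> (\<exists>t\<in>{0<..<1}. v t \<noteq> 0) \<and>
        (\<forall>t\<in>{0<..<1}.
           (v has_real_derivative v' t) (at t) \<and>
           (\<exists>d. (v' has_real_derivative d) (at t) \<and> d + l * v t = 0))}"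

definition A_const :: "nat \<Rightarrow> real \<Rightarrow> real \<Rightarrow> real \<Rightarrow> real" where
  "A_const N p R Rb =
     (R * Rb) powr ((N - p) / (p - 1)) /
     (Rb powr ((N - p) / (p - 1)) - R powr ((N - p) / (p - 1)))"

definition B_const :: "nat \<Rightarrow> real \<Rightarrow> real \<Rightarrow> real \<Rightarrow> real" where
  "B_const N p R Rb =
     Rb powr ((N - p) / (p - 1)) /
     (Rb powr ((N - p) / (p - 1)) - R powr ((N - p) / (p - 1)))"

text \<open>The weight \<open>q\<close> for \<open>0 < R < Rb\<close> and \<open>1 < p \<le> N\<close>; the second branch is the case \<open>N = p\<close>.\<close>
definition weight :: "nat \<Rightarrow> real \<Rightarrow> real \<Rightarrow> real \<Rightarrow> real \<Rightarrow> real" where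
  "weight N p R Rb t =
     (if real N > p then
        ((p - 1) / (N - p)) powr p *
        (A_const N p R Rb powr ((p - 1) * p / (N - p)) /
         (B_const N p R Rb - t) powr (p * (real N - 1) / (N - p)))
      else (R * (Rb / R) powr t * ln (Rb / R)) powr p)"

definition qbar_minus :: "nat \<Rightarrow> real \<Rightarrow> real \<Rightarrow> real \<Rightarrow> real" where
  "qbar_minus N p R Rb = integral {0..1} (\<lambda>t. min 1 (weight N p R Rb t))"

definition qbar_plus :: "nat \<Rightarrow> real \<Rightarrow> real \<Rightarrow> real \<Rightarrow> real" where
  "qbar_plus N p R Rb = integral {0..1} (\<lambda>t. max 1 (weight N p R Rb t))"

definition pi_p :: "real \<Rightarrow> real" where
  "pi_p p = 2 * pi * (p - 1) powr (1 / p) / (p * sin (pi / p))"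

end

theory Submission
  imports Defs "HOL-Real_Asymp.Real_Asymp"
begin

text \<open>
  The weight \<open>q\<close> is squeezed between its values at \<open>0\<close> and \<open>1\<close>, both of which tend to \<open>1\<close>.

  For the eigenvalues no change of variables is made: the radial problem on \<open>(R, R + 1)\<close> is
  \<open>(a |w'|\<^sup>p\<^sup>-\<^sup>2 w')' + \<lambda> a |w|\<^sup>p\<^sup>-\<^sup>2 w = 0\<close> with \<open>a r = (r / R)\<^sup>N\<^sup>-\<^sup>1\<close>, and \<open>a\<close> tends to \<open>1\<close> uniformly.
  A Pruefer transformation with the generalised sine turns this problem into the scalar equation
  \<open>\<theta>' = \<alpha> (b (1 - |sin\<^sub>p \<theta>|\<^sup>p) + a |sin\<^sub>p \<theta>|\<^sup>p)\<close>, \<open>\<theta> = 0\<close> at the left end, where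
  \<open>\<lambda> = (p - 1) \<alpha>\<^sup>p\<close> and \<open>b\<close> is the power \<open>-1 / (p - 1)\<close> of \<open>a\<close>. Its right-hand side is positive and
  Lipschitz in \<open>\<theta>\<close>, so the final angle is a continuous, strictly increasing function of \<open>\<alpha>\<close>,
  and \<open>\<lambda>\<close> is the \<open>k\<close>-th eigenvalue iff the final angle is \<open>k\<close> times the half period of \<open>sin\<^sub>p\<close>.
  Bounds \<open>m \<le> a, b \<le> M\<close> confine the final angle to \<open>[\<alpha> m, \<alpha> M]\<close>, which pins down \<open>\<lambda>\<^sub>k\<close> as \<open>m\<close>
  and \<open>M\<close> tend to \<open>1\<close>.
\<close>

section \<open>Signed powers\<close>

text \<open>The planar system for a solution and its flux is not Lipschitz unless
  \<open>p = 2\<close>: one of the exponents \<open>p - 1\<close> and \<open>1 / (p - 1)\<close> is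
  below one, so uniqueness and dependence on the parameter cannot be read off from it directly. The
  function |sin_p|^p, however, is continuously differentiable with derivative at most
  \<open>p\<close>, and the angle equation sees its unknown only through this function; the delicate
  analysis is therefore done on the scalar equation. The radius is controlled separately by a
  Gronwall estimate for |y|^p + |z|^(p/(p-1)), whose derivative is bounded by a multiple of itself.
  The factor \<open>p - 1\<close> in \<lambda> = (p - 1) \<alpha>^p matches the equation solved by
  the generalised sine, so that \<alpha> multiplies the whole right-hand side of the angle equation;
  monotonicity and two-sided bounds follow at once, and the index of an eigenvalue comes from
  counting half periods of the final angle instead of zeros of eigenfunctions. Dividing the radial
  weight by R^(N-1) leaves the eigenvalues unchanged and is what brings the weight close to
  one.\<close>

definition spow :: "real \<Rightarrow> real \<Rightarrow> real" where
  "spow a x = sgn x * \<bar>x\<bar> powr a"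

lemma spow_0 [simp]: "spow a 0 = 0"
  by (simp add: spow_def)

lemma spow_minus [simp]: "spow a (- x) = - spow a x"
  by (simp add: spow_def sgn_minus)

lemma abs_spow [simp]: "\<bar>spow a x\<bar> = \<bar>x\<bar> powr a"
  by (simp add: spow_def abs_mult sgn_if)

lemma spow_eq_0_iff [simp]: "spow a x = 0 \<longleftrightarrow> x = 0"
  by (simp add: spow_def sgn_if)

lemma sgn_spow [simp]: "sgn (spow a x) = sgn x"
  by (simp add: spow_def sgn_mult sgn_if)

lemma spow_spow: "spow a (spow b x) = spow (a * b) x"
  unfolding spow_def [of a] sgn_spow abs_spow by (simp add: spow_def powr_powr mult.commute)

lemma spow_1 [simp]: "spow 1 x = x"
  by (simp add: spow_def sgn_mult_abs)

lemma spow_mult: "spow a (x * y) = spow a x * spow a y"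
  by (simp add: spow_def sgn_mult abs_mult powr_mult)

lemma spow_of_pos: "x > 0 \<Longrightarrow> spow a x = x powr a"
  by (simp add: spow_def)

lemma spow_eq_abs_powr_mult: "spow a x = \<bar>x\<bar> powr (a - 1) * x"
  by (cases "x = 0") (auto simp: spow_def powr_diff sgn_if)

lemma spow_mult_self: "spow a x * x = \<bar>x\<bar> powr (a + 1)"
  by (cases "x = 0") (auto simp: spow_def powr_add sgn_if)

lemma phi_real: "phi p (x::real) = spow (p - 1) x"
  by (simp add: phi_def spow_eq_abs_powr_mult)

lemma isCont_spow:
  assumes "a > 0"
  shows "isCont (spow a) x"
proof (cases "x = 0")
  case True
  have "((\<lambda>x::real. \<bar>x\<bar> powr a) \<longlongrightarrow> 0 powr a) (at 0)"
    using assms by (intro tendsto_powr2) (auto intro!: tendsto_eq_intros always_eventually)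
  hence "(spow a \<longlongrightarrow> 0) (at 0)"
    using assms by (intro tendsto_rabs_zero_cancel [of "spow a"]) simp
  thus ?thesis
    using True by (simp add: isCont_def)
next
  case False
  thus ?thesis
    unfolding spow_eq_abs_powr_mult by (intro continuous_intros) auto
qed

lemma continuous_on_spow [continuous_intros]:
  "a > 0 \<Longrightarrow> continuous_on S f \<Longrightarrow> continuous_on S (\<lambda>x. spow a (f x))"
  using continuous_on_compose2 [of UNIV "spow a" S f] isCont_spow
  by (auto simp: continuous_at_imp_continuous_on)

lemma DERIV_spow:
  assumes "x \<noteq> 0"
  shows "(spow a has_real_derivative a * \<bar>x\<bar> powr (a - 1)) (at x)"
proof (cases "x > 0")
  case True
  have "((\<lambda>x. x powr a) has_real_derivative a * x powr (a - 1)) (at x)"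
    by (rule has_real_derivative_powr) fact
  moreover have "\<forall>\<^sub>F y in nhds x. spow a y = y powr a"
    using eventually_nhds_in_open [of "{0<..}" x] True
    by (auto elim!: eventually_mono simp: spow_def)
  ultimately show ?thesis
    using True by (simp add: DERIV_cong_ev)
next
  case False
  hence "x < 0" using assms by simp
  have "((\<lambda>x. - ((- x) powr a)) has_real_derivative a * (- x) powr (a - 1)) (at x)"
    by (rule derivative_eq_intros refl | use \<open>x < 0\<close> in simp)+
  moreover have "\<forall>\<^sub>F y in nhds x. spow a y = - ((- y) powr a)"
    using eventually_nhds_in_open [of "{..<0}" x] \<open>x < 0\<close>
    by (auto elim!: eventually_mono simp: spow_def)
  ultimately show ?thesis
    using \<open>x < 0\<close> by (simp add: DERIV_cong_ev)
qed

lemma DERIV_abs_powr: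
  fixes p :: real
  assumes "p > 1"
  shows "((\<lambda>x. \<bar>x\<bar> powr p) has_real_derivative p * spow (p - 1) x) (at x)"
proof (cases "x = 0")
  case True
  have "(\<lambda>h. \<bar>h\<bar> powr p / h) = spow (p - 1)"
    by (auto simp: fun_eq_iff spow_def powr_diff sgn_if)
  moreover have "(spow (p - 1) \<longlongrightarrow> 0) (at 0)"
    using isCont_spow [of "p - 1" 0] assms by (simp add: isCont_def)
  ultimately show ?thesis
    using True assms by (simp add: DERIV_def)
next
  case False
  have eq: "\<bar>y\<bar> powr p = spow (p - 1) y * y" for y
    by (simp add: spow_mult_self)
  have "((\<lambda>y. spow (p - 1) y * y) has_real_derivative
      (p - 1) * \<bar>x\<bar> powr (p - 1 - 1) * x + 1 * spow (p - 1) x) (at x)"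
    by (intro DERIV_mult DERIV_spow False DERIV_ident)
  also have "(p - 1) * \<bar>x\<bar> powr (p - 1 - 1) * x + 1 * spow (p - 1) x = p * spow (p - 1) x"
    unfolding spow_eq_abs_powr_mult [of "p - 1"] by (simp add: algebra_simps)
  finally show ?thesis
    unfolding eq .
qed

text \<open>L'Hopital's rule carries a derivative formula across an isolated exceptional point once
  the function and the candidate derivative are continuous there. It serves the generalised sine and
  cosine, whose chain rule breaks down at the zeros of \<open>sin\<close> and
  \<open>cos\<close>.\<close>

lemma DERIV_at_removable_point:
  fixes f g :: "real \<Rightarrow> real"
  assumes "isCont f x" "isCont g x" "\<forall>\<^sub>F y in at x. (f has_real_derivative g y) (at y)"
  shows "(f has_real_derivative g x) (at x)"
proof -
  have "((\<lambda>y. (f y - f x) / (y - x)) \<longlongrightarrow> g x) (at x)"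
  proof (rule lhopital)
    show "((\<lambda>y. f y - f x) \<longlongrightarrow> 0) (at x)"
      using assms(1) LIM_zero isCont_def by blast
    show "((\<lambda>y. y - x) \<longlongrightarrow> 0) (at x)"
      by (auto intro!: tendsto_eq_intros)
    show "\<forall>\<^sub>F y in at x. y - x \<noteq> 0"
      by (simp add: eventually_at_filter)
    show "\<forall>\<^sub>F y in at x. ((\<lambda>y. f y - f x) has_real_derivative g y) (at y)"
      using assms(3) by eventually_elim (auto intro!: derivative_eq_intros)
    show "\<forall>\<^sub>F y in at x. ((\<lambda>y. y - x) has_real_derivative 1) (at y)"
      by (auto intro!: derivative_eq_intros always_eventually)
    show "((\<lambda>y. g y / 1) \<longlongrightarrow> g x) (at x)"
      using assms(2) by (simp add: isCont_def)
  qed simp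
  thus ?thesis
    by (simp add: has_field_derivative_iff)
qed

text \<open>The chain rule read backwards: a Caratheodory slope function for \<open>f\<close> is
  nonzero near \<open>\<theta> t\<close>, and dividing the difference quotient of the composition by
  it leaves that of \<theta>. Continuity of \<theta> suffices, which suits both inverse functions
  and an angle obtained by lifting.\<close>

lemma DERIV_cancel_outer:
  fixes f \<theta> :: "real \<Rightarrow> real"
  assumes f: "(f has_real_derivative m) (at (\<theta> t))" "m \<noteq> 0"
    and \<theta>: "continuous (at t within A) \<theta>"
    and comp: "((\<lambda>s. f (\<theta> s)) has_real_derivative l) (at t within A)"
  shows "(\<theta> has_real_derivative l / m) (at t within A)"
proof -
  obtain g where g: "\<And>z. f z - f (\<theta> t) = g z * (z - \<theta> t)" "isCont g (\<theta> t)" "g (\<theta> t) = m"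
    using f(1) unfolding CARAT_DERIV by blast
  have lim: "((\<lambda>s. g (\<theta> s)) \<longlongrightarrow> m) (at t within A)"
    using continuous_within_compose3 [OF g(2) \<theta>] g(3) by (simp add: continuous_within)
  have "((\<lambda>s. ((f (\<theta> s) - f (\<theta> t)) / (s - t)) / g (\<theta> s)) \<longlongrightarrow> l / m) (at t within A)"
    using comp lim f(2) by (intro tendsto_divide) (auto simp: has_field_derivative_iff)
  moreover have "\<forall>\<^sub>F s in at t within A.
      ((f (\<theta> s) - f (\<theta> t)) / (s - t)) / g (\<theta> s) = (\<theta> s - \<theta> t) / (s - t)"
    using tendsto_imp_eventually_ne [OF lim f(2)] by eventually_elim (simp add: g(1))
  ultimately show ?thesis
    unfolding has_field_derivative_iff by (rule Lim_transform_eventually)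
qed

section \<open>Generalised sine and cosine\<close>

text \<open>
  The curve \<open>|y|\<^sup>p + |z|\<^sup>p\<^sup>/\<^sup>(\<^sup>p\<^sup>-\<^sup>1\<^sup>) = 1\<close> is the image of the unit circle under signed powers of the
  coordinates; \<open>arc_density\<close> is the speed at which the generalised angle runs relative to the
  ordinary one. At the zeros of \<open>sin\<close> or \<open>cos\<close>, where one factor has a negative exponent, its
  value is the junk value \<open>0\<close>; this affects only a countable set.
\<close>

definition arc_density :: "real \<Rightarrow> real \<Rightarrow> real" where
  "arc_density p s = 2 / p * (\<bar>sin s\<bar> powr (2 / p - 1) * \<bar>cos s\<bar> powr (1 - 2 / p))"

text \<open>For p > 1 this is \<open>2 / p * Beta (1 / p) (1 - 1 / p)\<close>, the first positive
  zero of the generalised sine. It differs from \<open>pi_p p\<close> by the factor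
  \<open>(p - 1) powr (1 / p)\<close>, which the parametrisation \<lambda> = (p - 1) \<alpha>^p
  accounts for.\<close>

definition half_period :: "real \<Rightarrow> real" where
  "half_period p = 2 / p * (pi / sin (pi / p))"

lemma Beta_reflection_real:
  fixes a :: real
  shows "Beta a (1 - a) = pi / sin (pi * a)"
proof -
  have "complex_of_real (Gamma a * Gamma (1 - a)) = complex_of_real (pi / sin (pi * a))"
    using Gamma_reflection_complex [of "complex_of_real a"]
    by (simp add: Gamma_complex_of_real [symmetric] sin_of_real [symmetric])
  thus ?thesis
    by (simp only: Beta_def of_real_eq_iff) simp
qed

section \<open>Integrals of the angular density\<close>

lemma arc_density_nonneg: "p > 0 \<Longrightarrow> arc_density p s \<ge> 0"
  by (simp add: arc_density_def)

lemma arc_density_minus [simp]: "arc_density p (- s) = arc_density p s"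
  by (simp add: arc_density_def)

lemma arc_density_plus_pi [simp]: "arc_density p (s + pi) = arc_density p s"
  by (simp add: arc_density_def)

lemma arc_density_minus_pi [simp]: "arc_density p (s - pi) = arc_density p s"
  using arc_density_plus_pi [of p "s - pi"] by simp

text \<open>The substitution \<open>t = (sin s)\<^sup>2\<close> turns the Beta integral with
  parameters \<open>1 / p\<close> and \<open>1 - 1 / p\<close> into \<open>p\<close> times the
  integral of the density. The integrands may be unbounded at the ends, hence the open intervals and
  the change of variables for absolutely integrable functions.\<close>

lemma has_integral_arc_density_quarter:
  assumes "p > 1"
  shows "(arc_density p has_integral half_period p / 2) {0..pi/2}"
proof -
  let ?f = "\<lambda>t. t powr (1 / p - 1) * (1 - t) powr ((1 - 1 / p) - 1)"
  let ?S = "{0<..<pi/2}"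
  have "(?f has_integral Beta (1 / p) (1 - 1 / p)) {0<..<1}"
    using has_integral_Beta_real [of "1 / p" "1 - 1 / p"] assms
    by (simp add: has_integral_Icc_iff_Ioo)
  hence B: "?f absolutely_integrable_on {0<..<1}"
    "integral {0<..<1} ?f = p * (half_period p / 2)"
    using assms
    by (auto intro!: nonnegative_absolutely_integrable_1 integral_unique
        simp: integrable_on_def Beta_reflection_real half_period_def)
  have inj: "inj_on (\<lambda>s. (sin s)\<^sup>2) ?S"
  proof (rule inj_onI)
    fix x y assume xy: "x \<in> ?S" "y \<in> ?S" "(sin x)\<^sup>2 = (sin y)\<^sup>2"
    hence "sin x = sin y"
      using sin_gt_zero [of x] sin_gt_zero [of y] by (simp add: power2_eq_iff)
    thus "x = y"
      using xy by (intro sin_inj_pi [OF _ _ _ _ \<open>sin x = sin y\<close>]) auto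
  qed
  have img: "(\<lambda>s. (sin s)\<^sup>2) ` ?S = {0<..<1}"
  proof safe
    fix s assume s: "s \<in> ?S"
    hence "0 < sin s" "0 < cos s"
      by (auto intro: sin_gt_zero cos_gt_zero)
    hence "0 < (sin s)\<^sup>2" "0 < (cos s)\<^sup>2" by simp_all
    thus "(sin s)\<^sup>2 \<in> {0<..<1}"
      using sin_cos_squared_add [of s] unfolding greaterThanLessThan_iff by linarith
  next
    fix t :: real assume t: "t \<in> {0<..<1}"
    hence st: "0 < sqrt t" "- 1 < sqrt t" "- 1 \<le> sqrt t" "sqrt t < 1"
      by (auto intro: less_trans [of _ 0] order_trans [of _ 0])
    hence "arcsin (sqrt t) \<in> ?S" "(sin (arcsin (sqrt t)))\<^sup>2 = t"
      using t st arcsin_less_arcsin [of 0 "sqrt t"] arcsin_lt_bounded [of "sqrt t"] by auto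
    thus "t \<in> (\<lambda>s. (sin s)\<^sup>2) ` ?S" by (metis imageI)
  qed
  have der: "((\<lambda>s. (sin s)\<^sup>2) has_real_derivative 2 * sin s * cos s) (at s within ?S)" for s
    by (auto intro!: derivative_eq_intros)
  have eq: "\<bar>2 * sin s * cos s\<bar> * ?f ((sin s)\<^sup>2) = p * arc_density p s" if "s \<in> ?S" for s
  proof -
    have pos: "0 < sin s" "0 < cos s"
      using that by (auto intro: sin_gt_zero cos_gt_zero)
    \<comment> \<open>The Jacobian 2 sin cos is split between the two powers, raising each doubled
      exponent by one.\<close>
    have *: "x * x\<^sup>2 powr a = x powr (2 * a + 1)" if "x > 0" for x a :: real
    proof -
      have "x * x\<^sup>2 powr a = x powr 1 * (x powr 2) powr a"
        using that by (simp add: powr_numeral)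
      also have "\<dots> = x powr (2 * a + 1)"
        by (simp only: powr_powr powr_add mult.commute)
      finally show ?thesis .
    qed
    have "\<bar>2 * sin s * cos s\<bar> * ?f ((sin s)\<^sup>2) =
        2 * (sin s * (sin s)\<^sup>2 powr (1 / p - 1)) * (cos s * (cos s)\<^sup>2 powr (1 - 1 / p - 1))"
      using pos by (simp add: abs_mult cos_squared_eq mult_ac)
    also have "\<dots> = 2 * sin s powr (2 / p - 1) * cos s powr (1 - 2 / p)"
      using pos by (simp only: *) (simp add: algebra_simps)
    also have "\<dots> = p * arc_density p s"
      using pos assms by (simp add: arc_density_def)
    finally show ?thesis .
  qed
  have "(\<lambda>s. \<bar>2 * sin s * cos s\<bar> * ?f ((sin s)\<^sup>2)) absolutely_integrable_on ?S \<and>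
      integral ?S (\<lambda>s. \<bar>2 * sin s * cos s\<bar> * ?f ((sin s)\<^sup>2)) = p * (half_period p / 2)"
    using B unfolding img [symmetric]
    by (subst has_absolute_integral_change_of_variables_1' [OF _ der inj]) auto
  hence "((\<lambda>s. \<bar>2 * sin s * cos s\<bar> * ?f ((sin s)\<^sup>2)) has_integral p * (half_period p / 2)) ?S"
    using absolutely_integrable_on_def unfolding has_integral_iff by blast
  hence "((\<lambda>s. p * arc_density p s) has_integral p * (half_period p / 2)) ?S"
    by (rule has_integral_eq [rotated]) (use eq in simp)
  hence "((\<lambda>s. (1 / p) * (p * arc_density p s)) has_integral (1 / p) * (p * (half_period p / 2))) ?S"
    by (rule has_integral_mult_right)
  thus ?thesis
    using assms by (simp add: has_integral_Icc_iff_Ioo)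
qed

text \<open>The density is even and has period \<open>pi\<close>, so its integral over
  \<open>{pi / 2..pi}\<close> is that over \<open>{- (pi / 2)..0}\<close>, hence that over the first
  quarter.\<close>

lemma has_integral_arc_density_pi:
  assumes "p > 1"
  shows "(arc_density p has_integral half_period p) {0..pi}"
proof -
  note q = has_integral_arc_density_quarter [OF assms]
  have "((\<lambda>x. arc_density p (- x)) has_integral half_period p / 2) {- (pi / 2)..- 0}"
    using q by (subst has_integral_reflect_real)
  hence "(arc_density p has_integral half_period p / 2) {- (pi / 2)..0}"
    by simp
  from has_integral_shift_real_ivl [OF this, of "- pi"]
  have "(arc_density p has_integral half_period p / 2) {pi / 2..pi}"
    by (simp add: field_simps)
  from has_integral_combine [OF _ _ q this] show ?thesis by simp
qed

lemma arc_density_integrable: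
  assumes "p > 1"
  shows "arc_density p integrable_on {a..b}"
proof -
  have nat: "arc_density p integrable_on {0..real n * pi}" for n
  proof (induction n)
    case (Suc n)
    have shift: "arc_density p integrable_on {real m * pi..real m * pi + pi}" for m
    proof (induction m)
      case 0
      show ?case using has_integral_arc_density_pi [OF assms] by (auto simp: integrable_on_def)
    next
      case (Suc m)
      from integrable_shift_real_ivl [OF this, of "- pi"] show ?case
        by (simp add: algebra_simps)
    qed
    have "arc_density p integrable_on {0..real n * pi + pi}"
      by (rule Henstock_Kurzweil_Integration.integrable_combine [OF _ _ Suc shift]) auto
    thus ?case by (simp add: algebra_simps)
  next
    case 0
    show ?case using integrable_on_refl [of "arc_density p" "0::real"] by simp
  qed
  obtain n where n: "max \<bar>a\<bar> \<bar>b\<bar> < real n * pi"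
    using reals_Archimedean3 [OF pi_gt_zero] by metis
  have "(\<lambda>x. arc_density p (- x)) integrable_on {- (real n * pi)..- 0}"
    using nat by (simp only: Henstock_Kurzweil_Integration.integrable_reflect_real)
  hence "arc_density p integrable_on {- (real n * pi)..0}"
    by simp
  from Henstock_Kurzweil_Integration.integrable_combine [OF _ _ this nat]
  have "arc_density p integrable_on {- (real n * pi)..real n * pi}"
    by simp
  thus ?thesis
    by (rule integrable_on_subinterval) (use n in auto)
qed

text \<open>The generalised angle that belongs to the ordinary angle \<open>w\<close>. The case
  split is there because \<open>{0..w}\<close> is empty for negative \<open>w\<close>.\<close>

definition parc :: "real \<Rightarrow> real \<Rightarrow> real" where
  "parc p w = (if w \<ge> 0 then integral {0..w} (arc_density p) else - integral {w..0} (arc_density p))"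

lemma parc_diff:
  assumes "p > 1" "a \<le> b"
  shows "parc p b - parc p a = integral {a..b} (arc_density p)"
proof -
  note comb = Henstock_Kurzweil_Integration.integral_combine [OF _ _ arc_density_integrable [OF assms(1)]]
  consider "0 \<le> a" | "a < 0" "0 \<le> b" | "b < 0" using assms by linarith
  thus ?thesis
  proof cases
    case 1
    thus ?thesis using comb [of 0 a b] assms by (simp add: parc_def)
  next
    case 2
    thus ?thesis using comb [of a 0 b] by (simp add: parc_def)
  next
    case 3
    thus ?thesis using comb [of a b 0] assms by (simp add: parc_def)
  qed
qed

lemma parc_plus_integral:
  "p > 1 \<Longrightarrow> a \<le> x \<Longrightarrow> parc p a + integral {a..x} (arc_density p) = parc p x"
  using parc_diff [of p a x] by simp

lemma parc_0 [simp]: "parc p 0 = 0"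
  by (simp add: parc_def)

lemma parc_pi: "p > 1 \<Longrightarrow> parc p pi = half_period p"
  using has_integral_arc_density_pi by (simp add: parc_def integral_unique)

lemma half_period_pos: "p > 1 \<Longrightarrow> half_period p > 0"
  using sin_gt_zero [of "pi / p"] by (simp add: half_period_def field_simps)

lemma parc_plus_pi:
  assumes "p > 1"
  shows "parc p (w + pi) = parc p w + half_period p"
proof -
  have shift: "integral {a + pi..b + pi} (arc_density p) = integral {a..b} (arc_density p)" for a b
    using integral_shift_real_ivl [of a "- pi" b "arc_density p"] by simp
  show ?thesis
  proof (cases "w \<ge> 0")
    case True
    thus ?thesis
      using parc_diff [OF assms, of "0 + pi" "w + pi"] parc_diff [OF assms, of 0 w]
        shift [of 0 w] parc_pi [OF assms] by simp
  next
    case False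
    thus ?thesis
      using parc_diff [OF assms, of "w + pi" "0 + pi"] parc_diff [OF assms, of w 0]
        shift [of w 0] parc_pi [OF assms] by simp
  qed
qed

lemma parc_nat_pi: "p > 1 \<Longrightarrow> parc p (real n * pi) = real n * half_period p"
proof (induction n)
  case (Suc n)
  thus ?case using parc_plus_pi [of p "real n * pi"] by (simp add: algebra_simps)
qed simp

lemma parc_minus:
  assumes "p > 1"
  shows "parc p (- w) = - parc p w"
proof -
  have refl: "integral {- b..- a} (arc_density p) = integral {a..b} (arc_density p)" for a b
    using Henstock_Kurzweil_Integration.integral_reflect_real [of b a "arc_density p"] by simp
  show ?thesis
    using refl [of 0 w] refl [of w 0] by (auto simp: parc_def)
qed

lemma isCont_parc:
  assumes "p > 1"
  shows "isCont (parc p) w"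
proof -
  have "continuous_on {w - 1..w + 1} (\<lambda>x. parc p (w - 1) + integral {w - 1..x} (arc_density p))"
    by (intro continuous_intros indefinite_integral_continuous_1 arc_density_integrable assms)
  also have "?this \<longleftrightarrow> continuous_on {w - 1..w + 1} (parc p)"
    by (intro continuous_on_cong refl parc_plus_integral assms) simp
  finally show ?thesis
    by (rule continuous_on_interior) auto
qed

lemma DERIV_parc:
  assumes "p > 1" "sin w \<noteq> 0" "cos w \<noteq> 0"
  shows "(parc p has_real_derivative arc_density p w) (at w)"
proof -
  let ?I = "{w - 1..w + 1}"
  have "isCont (arc_density p) w"
    unfolding arc_density_def using assms by (intro continuous_intros) auto
  hence "((\<lambda>x. integral {w - 1..x} (arc_density p)) has_real_derivative arc_density p w) (at w within ?I)"
    using integral_has_vector_derivative_continuous_at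
      [OF arc_density_integrable [OF assms(1), of "w - 1" "w + 1"], of w "{}"]
    by (simp add: has_real_derivative_iff_has_vector_derivative continuous_at_imp_continuous_at_within)
  hence "((\<lambda>x. parc p (w - 1) + integral {w - 1..x} (arc_density p))
      has_real_derivative arc_density p w) (at w within ?I)"
    using DERIV_add [OF DERIV_const] by force
  hence "(parc p has_real_derivative arc_density p w) (at w within ?I)"
    by (rule has_field_derivative_transform_within [OF _ zero_less_one])
       (auto intro!: parc_plus_integral assms)
  thus ?thesis
    by (simp add: at_within_Icc_at)
qed

text \<open>The density vanishes only on a countable set, so every interval contains a point with
  strictly positive derivative; on either side of it weak monotonicity suffices.\<close>

lemma parc_strict_mono:
  assumes "p > 1"
  shows "strict_mono (parc p)"
proof (rule strict_monoI)
  fix a b :: real assume "a < b"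
  have mono: "parc p x \<le> parc p y" if "x \<le> y" for x y
  proof -
    have "parc p y - parc p x \<ge> 0"
      unfolding parc_diff [OF assms that]
      by (intro integral_nonneg arc_density_integrable arc_density_nonneg) (use assms in auto)
    thus ?thesis by simp
  qed
  \<comment> \<open>The double angle gathers the zeros of \<open>sin\<close> and of
    \<open>cos\<close> in one set.\<close>
  have "{x::real. sin (2 * x) = 0} \<subseteq> range (\<lambda>i::int. of_int i * pi / 2)"
  proof
    fix x :: real assume "x \<in> {x. sin (2 * x) = 0}"
    then obtain i :: int where "2 * x = of_int i * pi"
      by (auto simp: sin_zero_iff_int2)
    hence "x = of_int i * pi / 2" by simp
    thus "x \<in> range (\<lambda>i::int. of_int i * pi / 2)" by blast
  qed
  hence "countable {x::real. sin (2 * x) = 0}"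
    by (rule countable_subset) simp
  hence "uncountable ({a<..<b} - {x. sin (2 * x) = 0})"
    using \<open>a < b\<close> by (intro uncountable_minus_countable) (simp add: uncountable_open_interval)
  hence "{a<..<b} - {x. sin (2 * x) = 0} \<noteq> {}"
    by (intro notI) simp
  then obtain w where "w \<in> {a<..<b}" "sin (2 * w) \<noteq> 0"
    by blast
  hence w: "a < w" "w < b" "sin w \<noteq> 0" "cos w \<noteq> 0"
    by (auto simp: sin_double)
  have "arc_density p w > 0"
    using w assms by (simp add: arc_density_def)
  from DERIV_pos_inc_right [OF DERIV_parc [OF assms w(3,4)] this]
  obtain d where d: "d > 0" "\<And>h. 0 < h \<Longrightarrow> h < d \<Longrightarrow> parc p w < parc p (w + h)" by blast
  have "parc p a \<le> parc p w" by (rule mono) (use w in simp)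
  also have "parc p w < parc p (w + min (d / 2) (b - w))"
    by (rule d) (use d w in auto)
  also have "\<dots> \<le> parc p b" by (rule mono) auto
  finally show "parc p a < parc p b" .
qed

lemma parc_surj:
  assumes "p > 1"
  shows "\<exists>w. parc p w = x"
proof -
  obtain n where n: "\<bar>x\<bar> < real n * half_period p"
    using reals_Archimedean3 [OF half_period_pos [OF assms]] by blast
  have "\<exists>w\<ge>- (real n * pi). w \<le> real n * pi \<and> parc p w = x"
    using n assms isCont_parc [OF assms]
    by (intro IVT) (auto simp: parc_minus parc_nat_pi)
  thus ?thesis by blast
qed

section \<open>The inverse angle map, and the generalised sine and cosine\<close>

definition parc_inv :: "real \<Rightarrow> real \<Rightarrow> real" where
  "parc_inv p = inv (parc p)"

lemma parc_parc_inv [simp]: "p > 1 \<Longrightarrow> parc p (parc_inv p x) = x"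
  unfolding parc_inv_def using parc_surj [of p x] by (auto intro: f_inv_into_f)

lemma parc_inv_parc [simp]: "p > 1 \<Longrightarrow> parc_inv p (parc p w) = w"
  by (simp add: parc_inv_def parc_strict_mono strict_mono_imp_inj_on)

lemma isCont_parc_inv:
  assumes "p > 1"
  shows "isCont (parc_inv p) x"
  using isCont_inverse_function [of 1 "parc_inv p x" "parc_inv p" "parc p"] assms isCont_parc
  by simp

lemma DERIV_parc_inv:
  assumes "p > 1" "sin (parc_inv p x) \<noteq> 0" "cos (parc_inv p x) \<noteq> 0"
  shows "(parc_inv p has_real_derivative 1 / arc_density p (parc_inv p x)) (at x)"
proof (rule DERIV_cancel_outer [OF DERIV_parc [OF assms] _ isCont_parc_inv [OF assms(1)]])
  show "arc_density p (parc_inv p x) \<noteq> 0"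
    using assms by (simp add: arc_density_def)
  show "((\<lambda>s. parc p (parc_inv p s)) has_real_derivative 1) (at x)"
    using assms by simp
qed

text \<open>The exponents \<open>2 / p\<close> here and \<open>2 - 2 / p\<close> in
  \<open>pcos\<close> are chosen so that |psin|^p and |pcos|^(p/(p-1)) are the squares of the
  ordinary sine and cosine at the ordinary angle \<open>parc_inv p x\<close>.\<close>

definition psin :: "real \<Rightarrow> real \<Rightarrow> real" where
  "psin p x = spow (2 / p) (sin (parc_inv p x))"

definition pcos :: "real \<Rightarrow> real \<Rightarrow> real" where
  "pcos p x = spow (2 - 2 / p) (cos (parc_inv p x))"

lemma isCont_psin: "p > 1 \<Longrightarrow> isCont (psin p) x"
  unfolding psin_def
  by (rule isCont_o2 [OF _ isCont_spow]) (auto intro!: continuous_intros isCont_parc_inv)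

lemma isCont_pcos: "p > 1 \<Longrightarrow> isCont (pcos p) x"
  unfolding pcos_def
  by (rule isCont_o2 [OF _ isCont_spow]) (auto intro!: continuous_intros isCont_parc_inv simp: field_simps)

text \<open>The zeros of \<open>sin (2 * w)\<close> are simple, hence isolated, and the continuous
  injection \<open>parc_inv p\<close> carries this back to \<open>x\<close>.\<close>

lemma eventually_sin_cos_parc_inv_neq_0:
  assumes "p > 1"
  shows "\<forall>\<^sub>F y in at x. sin (parc_inv p y) \<noteq> 0 \<and> cos (parc_inv p y) \<noteq> 0"
proof -
  have "\<forall>\<^sub>F w in at w0. sin (2 * w) \<noteq> 0" for w0 :: real
  proof (cases "sin (2 * w0) = 0")
    case True
    have "((\<lambda>w. sin (2 * w)) has_real_derivative cos (2 * w0) * 2) (at w0)"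
      by (auto intro!: derivative_eq_intros)
    hence "((\<lambda>w. sin (2 * w) / (w - w0)) \<longlongrightarrow> cos (2 * w0) * 2) (at w0)"
      using True by (simp add: has_field_derivative_iff)
    moreover have "cos (2 * w0) * 2 \<noteq> 0"
      using sin_cos_squared_add [of "2 * w0"] True by auto
    ultimately show ?thesis
      by (rule tendsto_imp_eventually_ne [THEN eventually_mono]) auto
  next
    case False
    have "((\<lambda>w. sin (2 * w)) \<longlongrightarrow> sin (2 * w0)) (at w0)"
      by (intro tendsto_intros)
    thus ?thesis using False by (rule tendsto_imp_eventually_ne)
  qed
  moreover have "filterlim (parc_inv p) (at (parc_inv p x)) (at x)"
    unfolding filterlim_at
  proof
    show "\<forall>\<^sub>F y in at x. parc_inv p y \<in> UNIV \<and> parc_inv p y \<noteq> parc_inv p x"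
      unfolding eventually_at_filter
      by (rule always_eventually) (metis UNIV_I assms parc_parc_inv)
    show "(parc_inv p \<longlongrightarrow> parc_inv p x) (at x)"
      using isCont_parc_inv [OF assms] by (simp add: isCont_def)
  qed
  ultimately have "\<forall>\<^sub>F y in at x. sin (2 * parc_inv p y) \<noteq> 0"
    by (rule eventually_compose_filterlim)
  thus ?thesis
    by eventually_elim (auto simp: sin_double)
qed

text \<open>Away from the exceptional points the powers of \<open>sin\<close> in the chain rule
  cancel against the density and leave a power of \<open>cos\<close>; the identity
  \<open>1 / (p - 1) * (2 - 2 / p) = 2 / p\<close> recognises it as a power of \<open>pcos\<close>.
  The exceptional points are removable.\<close>

lemma DERIV_psin:
  assumes "p > 1"
  shows "(psin p has_real_derivative spow (1 / (p - 1)) (pcos p x)) (at x)"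
proof (rule DERIV_at_removable_point [OF isCont_psin [OF assms]])
  show "isCont (\<lambda>x. spow (1 / (p - 1)) (pcos p x)) x"
    using assms by (intro isCont_o2 [OF isCont_pcos isCont_spow]) auto
  show "\<forall>\<^sub>F y in at x. (psin p has_real_derivative spow (1 / (p - 1)) (pcos p y)) (at y)"
    using eventually_sin_cos_parc_inv_neq_0 [OF assms]
  proof eventually_elim
    case (elim y)
    let ?s = "sin (parc_inv p y)" and ?c = "cos (parc_inv p y)"
    have "((\<lambda>x. spow (2 / p) (sin (parc_inv p x))) has_real_derivative
        2 / p * \<bar>?s\<bar> powr (2 / p - 1) * (?c * (1 / arc_density p (parc_inv p y)))) (at y)"
      using elim assms
      by (intro DERIV_chain2 [OF DERIV_spow] DERIV_chain2 [OF DERIV_sin] DERIV_parc_inv) auto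
    also have "2 / p * \<bar>?s\<bar> powr (2 / p - 1) * (?c * (1 / arc_density p (parc_inv p y))) =
        \<bar>?c\<bar> powr (2 / p - 1) * ?c"
    proof -
      have "\<bar>?c\<bar> powr (2 / p - 1) * \<bar>?c\<bar> powr (1 - 2 / p) = 1"
        using elim by (simp flip: powr_add)
      thus ?thesis
        using elim assms by (simp add: arc_density_def divide_simps)
    qed
    also have "\<dots> = spow (1 / (p - 1)) (pcos p y)"
    proof -
      have "1 / (p - 1) * (2 - 2 / p) = 2 / p"
        using assms by (simp add: field_simps)
      thus ?thesis
        by (simp only: pcos_def spow_spow spow_eq_abs_powr_mult [of "2 / p"])
    qed
    finally show ?case
      by (simp add: psin_def [abs_def])
  qed
qed

text \<open>The same cancellation with \<open>sin\<close> and \<open>cos\<close> exchanged. Together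
  with the derivative of \<open>psin\<close> it says that the pair solves the model system with both
  coefficients equal to one.\<close>

lemma DERIV_pcos:
  assumes "p > 1"
  shows "(pcos p has_real_derivative - (p - 1) * spow (p - 1) (psin p x)) (at x)"
proof (rule DERIV_at_removable_point [OF isCont_pcos [OF assms]])
  show "isCont (\<lambda>x. - (p - 1) * spow (p - 1) (psin p x)) x"
    using assms by (intro continuous_mult continuous_const isCont_o2 [OF isCont_psin isCont_spow]) auto
  show "\<forall>\<^sub>F y in at x. (pcos p has_real_derivative - (p - 1) * spow (p - 1) (psin p y)) (at y)"
    using eventually_sin_cos_parc_inv_neq_0 [OF assms]
  proof eventually_elim
    case (elim y)
    let ?s = "sin (parc_inv p y)" and ?c = "cos (parc_inv p y)"
    have "((\<lambda>x. spow (2 - 2 / p) (cos (parc_inv p x))) has_real_derivative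
        (2 - 2 / p) * \<bar>?c\<bar> powr ((2 - 2 / p) - 1) * (- ?s * (1 / arc_density p (parc_inv p y)))) (at y)"
      using elim assms
      by (intro DERIV_chain2 [OF DERIV_spow] DERIV_chain2 [OF DERIV_cos] DERIV_parc_inv) auto
    also have "(2 - 2 / p) * \<bar>?c\<bar> powr ((2 - 2 / p) - 1) * (- ?s * (1 / arc_density p (parc_inv p y))) =
        - (p - 1) * (\<bar>?s\<bar> powr ((2 - 2 / p) - 1) * ?s)"
    proof -
      have "(2 - 2 / p) - 1 = 1 - 2 / p" by simp
      moreover have "\<bar>?s\<bar> powr (2 / p - 1) * \<bar>?s\<bar> powr (1 - 2 / p) = 1"
        using elim by (simp flip: powr_add)
      ultimately show ?thesis
        using elim assms by (simp add: arc_density_def divide_simps) (simp add: algebra_simps)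
    qed
    also have "\<dots> = - (p - 1) * spow (p - 1) (psin p y)"
    proof -
      have "(p - 1) * (2 / p) = 2 - 2 / p"
        using assms by (simp add: field_simps)
      thus ?thesis
        by (simp only: psin_def spow_spow spow_eq_abs_powr_mult [of "2 - 2 / p"])
    qed
    finally show ?case
      by (simp add: pcos_def [abs_def])
  qed
qed

lemma psin_pcos_energy:
  assumes "p > 1"
  shows "\<bar>psin p x\<bar> powr p + \<bar>pcos p x\<bar> powr (p / (p - 1)) = 1"
proof -
  have 1: "(2 - 2 / p) * (p / (p - 1)) = 2" "2 / p * p = 2"
    using assms by (simp_all add: field_simps)
  have 2: "\<bar>w\<bar> powr 2 = w\<^sup>2" for w :: real
    by (cases "w = 0") (auto simp: powr_numeral)
  show ?thesis
    unfolding psin_def pcos_def abs_spow powr_powr 1 2 by simp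
qed

lemma psin_0 [simp]: "p > 1 \<Longrightarrow> psin p 0 = 0"
  using parc_inv_parc [of p 0] by (simp add: psin_def)

lemma pcos_0 [simp]: "p > 1 \<Longrightarrow> pcos p 0 = 1"
  using parc_inv_parc [of p 0] by (simp add: pcos_def spow_def)

lemma psin_nat_half_period: "p > 1 \<Longrightarrow> psin p (real n * half_period p) = 0"
  using parc_inv_parc [of p "real n * pi"] by (simp add: psin_def parc_nat_pi)

lemma psin_eq_0_imp:
  assumes "p > 1" "psin p x = 0" "x > 0"
  obtains n where "n \<ge> 1" "x = real n * half_period p"
proof -
  from assms(2) obtain i :: int where i: "parc_inv p x = of_int i * pi"
    by (auto simp: psin_def sin_zero_iff_int2)
  have "parc p 0 < parc p (of_int i * pi)"
    using assms parc_parc_inv [of p x] i by simp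
  hence "0 < of_int i * pi"
    by (rule strict_mono_less [OF parc_strict_mono [OF assms(1)], THEN iffD1])
  hence "i > 0" by (simp add: zero_less_mult_iff)
  hence "parc_inv p x = real (nat i) * pi"
    using i by simp
  hence "x = real (nat i) * half_period p"
    using parc_nat_pi [OF assms(1), of "nat i"] parc_parc_inv [OF assms(1), of x] by simp
  thus ?thesis using \<open>i > 0\<close> by (intro that [of "nat i"]) auto
qed

lemma DERIV_abs_psin_powr:
  assumes "p > 1"
  shows "((\<lambda>x. \<bar>psin p x\<bar> powr p) has_real_derivative
    p * spow (p - 1) (psin p x) * spow (1 / (p - 1)) (pcos p x)) (at x)"
  using DERIV_chain2 [OF DERIV_abs_powr [OF assms] DERIV_psin [OF assms]] .

text \<open>The two factors are at most the powers of \<open>E\<close> with exponents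
  \<open>(p - 1) / p\<close> and \<open>1 / p\<close>, which sum to one. The bound yields both the
  Lipschitz constant of the angle equation and the Gronwall constant of the energy.\<close>

lemma abs_spow_mult_spow_le:
  fixes y z E :: real
  assumes "p > 1" "\<bar>y\<bar> powr p \<le> E" "\<bar>z\<bar> powr (p / (p - 1)) \<le> E"
  shows "\<bar>spow (p - 1) y * spow (1 / (p - 1)) z\<bar> \<le> E"
proof -
  have E: "E \<ge> 0" using assms(2) powr_ge_zero order_trans by blast
  have "\<bar>y\<bar> powr (p - 1) = (\<bar>y\<bar> powr p) powr ((p - 1) / p)"
    using assms by (simp add: powr_powr)
  also have "\<dots> \<le> E powr ((p - 1) / p)"
    using assms by (intro powr_mono2) auto
  finally have y: "\<bar>y\<bar> powr (p - 1) \<le> E powr ((p - 1) / p)" .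
  have "\<bar>z\<bar> powr (1 / (p - 1)) = (\<bar>z\<bar> powr (p / (p - 1))) powr (1 / p)"
    using assms by (simp add: powr_powr)
  also have "\<dots> \<le> E powr (1 / p)"
    using assms by (intro powr_mono2) auto
  finally have z: "\<bar>z\<bar> powr (1 / (p - 1)) \<le> E powr (1 / p)" .
  have "\<bar>spow (p - 1) y * spow (1 / (p - 1)) z\<bar> \<le> E powr ((p - 1) / p) * E powr (1 / p)"
    unfolding abs_mult abs_spow by (intro mult_mono y z) auto
  also have "\<dots> = E"
    using E assms by (simp flip: powr_add add: field_simps)
  finally show ?thesis .
qed

text \<open>The derivative is \<open>p\<close> times a product that the identity on the curve bounds
  by one. This gives the angle equation a Lipschitz constant even where the planar system has
  none.\<close>

lemma abs_psin_powr_lipschitz: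
  assumes "p > 1"
  shows "\<bar>\<bar>psin p x\<bar> powr p - \<bar>psin p y\<bar> powr p\<bar> \<le> p * \<bar>x - y\<bar>"
proof -
  have "norm (\<bar>psin p x\<bar> powr p - \<bar>psin p y\<bar> powr p) \<le> p * norm (x - y)"
  proof (rule field_differentiable_bound [of UNIV])
    fix w
    have "\<bar>psin p w\<bar> powr p \<le> 1" "\<bar>pcos p w\<bar> powr (p / (p - 1)) \<le> 1"
      using psin_pcos_energy [OF assms, of w] powr_ge_zero
      by (smt (verit))+
    from abs_spow_mult_spow_le [OF assms this]
    show "norm (p * spow (p - 1) (psin p w) * spow (1 / (p - 1)) (pcos p w)) \<le> p"
      using assms by (simp add: abs_mult mult.assoc)
  qed (use DERIV_abs_psin_powr [OF assms] in auto)
  thus ?thesis by simp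
qed

text \<open>Signed powers map the curve back to the unit circle, where a continuous logarithm yields the
  angle.\<close>

lemma psin_pcos_lift:
  fixes y z :: "real \<Rightarrow> real"
  assumes p: "p > 1" and cont: "continuous_on {c..d} y" "continuous_on {c..d} z"
    and curve: "\<And>t. t \<in> {c..d} \<Longrightarrow> \<bar>y t\<bar> powr p + \<bar>z t\<bar> powr (p / (p - 1)) = 1"
    and init: "c \<le> d" "y c = 0" "z c > 0"
  obtains \<theta> where "continuous_on {c..d} \<theta>" "\<theta> c = 0"
    "\<And>t. t \<in> {c..d} \<Longrightarrow> psin p (\<theta> t) = y t \<and> pcos p (\<theta> t) = z t"
proof -
  \<comment> \<open>With this exponent the square of \<open>spow ?q (z t)\<close> is |z
    t|^(p/(p-1)), so that \<open>f\<close> has modulus one.\<close>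
  let ?q = "p / (2 * (p - 1))"
  define f where "f t = Complex (spow ?q (z t)) (spow (p / 2) (y t))" for t
  have 2: "(\<bar>w\<bar> powr a)\<^sup>2 = \<bar>w\<bar> powr (2 * a)" for w a :: real
    by (cases "w = 0") (auto simp: powr_power)
  have norm: "norm (f t) = 1" if "t \<in> {c..d}" for t
  proof -
    have "(norm (f t))\<^sup>2 = \<bar>spow ?q (z t)\<bar>\<^sup>2 + \<bar>spow (p / 2) (y t)\<bar>\<^sup>2"
      by (simp add: cmod_power2 f_def del: abs_spow)
    also have "\<dots> = \<bar>z t\<bar> powr (2 * ?q) + \<bar>y t\<bar> powr (2 * (p / 2))"
      by (simp only: abs_spow 2)
    also have "2 * ?q = p / (p - 1)" using p by (simp add: field_simps)
    finally have "(norm (f t))\<^sup>2 = 1"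
      using curve [OF that] by simp
    thus ?thesis
      using norm_ge_zero [of "f t"] by (simp add: power2_eq_1_iff)
  qed
  have "continuous_on {c..d} f"
    unfolding f_def using p cont by (intro continuous_intros) auto
  moreover have "f t \<noteq> 0" if "t \<in> {c..d}" for t
    using norm [OF that] by auto
  ultimately obtain g where g: "continuous_on {c..d} g" "\<And>t. t \<in> {c..d} \<Longrightarrow> f t = exp (g t)"
    using continuous_logarithm_on_contractible [of "{c..d}" f] convex_imp_contractible [of "{c..d}"]
    by auto
  have "Re (g t) = 0" if "t \<in> {c..d}" for t
    using norm [OF that] g(2) [OF that] by simp
  hence cs: "cos (Im (g t)) = spow ?q (z t)" "sin (Im (g t)) = spow (p / 2) (y t)" if "t \<in> {c..d}" for t
    using g(2) [OF that] that by (auto simp: f_def complex_eq_iff Re_exp Im_exp)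
  \<comment> \<open>Positivity of \<open>z c\<close> excludes the starting point half a turn away:
    the cosine at \<open>c\<close> is \<open>1\<close>, so the imaginary part of the logarithm
    starts at a multiple of 2 pi, which is subtracted below.\<close>
  have "\<bar>z c\<bar> powr (p / (p - 1)) = 1"
    using curve [of c] init by simp
  hence "(z c powr (p / (p - 1))) powr (1 / 2) = 1"
    using init by simp
  hence "spow ?q (z c) = 1"
    using init p by (simp add: powr_powr spow_of_pos mult.commute)
  hence "cos (Im (g c)) = 1"
    using cs [of c] init by simp
  then obtain m :: int where m: "Im (g c) = of_int m * 2 * pi"
    by (auto simp: cos_one_2pi_int)
  define \<theta> where "\<theta> t = parc p (Im (g t) - of_int m * (2 * pi))" for t
  show thesis
  proof
    show "continuous_on {c..d} \<theta>"
      unfolding \<theta>_def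
      by (rule continuous_on_compose2 [OF continuous_at_imp_continuous_on [of UNIV "parc p"]])
         (use isCont_parc [OF p] g(1) in \<open>auto intro!: continuous_intros\<close>)
    show "\<theta> c = 0" by (simp add: \<theta>_def m)
    show "psin p (\<theta> t) = y t \<and> pcos p (\<theta> t) = z t" if t: "t \<in> {c..d}" for t
    proof -
      have per: "cos (x - of_int m * (2 * pi)) = cos x" "sin (x - of_int m * (2 * pi)) = sin x" for x
        by (simp_all add: cos_diff sin_diff mult.commute [of "of_int m"])
      have "(2 - 2 / p) * ?q = 1" "2 / p * (p / 2) = 1"
        using p by (simp_all add: field_simps)
      thus ?thesis
        using p by (simp only: psin_def pcos_def \<theta>_def parc_inv_parc per cs [OF t] spow_spow) simp
    qed
  qed
qed

section \<open>Scalar differential equations\<close>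

lemma has_integral_exp_scaled:
  fixes K c t :: real
  assumes "K \<noteq> 0" "c \<le> t"
  shows "((\<lambda>s. exp (K * (s - c))) has_integral (exp (K * (t - c)) - 1) / K) {c..t}"
proof -
  have "((\<lambda>s. exp (K * (s - c))) has_integral exp (K * (t - c)) / K - exp (K * (c - c)) / K) {c..t}"
    using assms
    by (intro fundamental_theorem_of_calculus)
       (auto intro!: derivative_eq_intros simp flip: has_real_derivative_iff_has_vector_derivative)
  thus ?thesis by (simp add: diff_divide_distrib)
qed

text \<open>The weight \<open>exp (- K (t - c))\<close> makes the Picard operator a contraction on the whole interval.\<close>

lemma picard_global_lipschitz:
  fixes F :: "real \<Rightarrow> real \<Rightarrow> real"
  assumes cd: "c \<le> d"
    and F: "continuous_on ({c..d} \<times> UNIV) (\<lambda>(t, x). F t x)"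
    and lip: "\<And>t x y. t \<in> {c..d} \<Longrightarrow> \<bar>F t x - F t y\<bar> \<le> L * \<bar>x - y\<bar>"
  obtains \<theta> where "\<theta> c = 0"
    "\<And>t. t \<in> {c..d} \<Longrightarrow> (\<theta> has_real_derivative F t (\<theta> t)) (at t within {c..d})"
proof -
  have L: "L \<ge> 0" using lip [of c 1 0] cd by simp
  \<comment> \<open>The contraction constant will be \<open>L / K\<close>; adding one keeps it below
    one and \<open>K\<close> positive even when \<open>L\<close> is zero.\<close>
  define K where "K = L + 1"
  have K: "K > 0" using L by (simp add: K_def)
  \<comment> \<open>Clamping to the interval turns functions on it into bounded continuous functions
    on the whole line, the complete space in which the fixed point is sought.\<close>
  define cl where "cl t = max c (min d t)" for t
  have cl: "cl t \<in> {c..d}" for t using cd by (auto simp: cl_def)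
  \<comment> \<open>The Picard operator conjugated by the weight: \<open>x\<close> stands for exp(-
    K (t - c)) times the sought solution.\<close>
  define G where "G x t = exp (- K * (t - c)) * integral {c..t} (\<lambda>s. F s (exp (K * (s - c)) * x s))"
    for x :: "real \<Rightarrow> real" and t
  have contF: "continuous_on {c..t} (\<lambda>s. F s (exp (K * (s - c)) * x s))"
    if "continuous_on UNIV x" "t \<le> d" for x t
    by (rule continuous_on_compose2 [OF F, of _ "\<lambda>s. (s, exp (K * (s - c)) * x s)", simplified])
       (use that in \<open>auto intro!: continuous_intros intro: continuous_on_subset\<close>)
  have contG: "continuous_on {c..d} (G x)" if "continuous_on UNIV x" for x
    unfolding G_def
    by (intro continuous_intros indefinite_integral_continuous_1 integrable_continuous_interval contF that) simp
  have bc: "(\<lambda>t. G x (cl t)) \<in> bcontfun" if x: "continuous_on UNIV x" for x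
  proof -
    have "continuous_on UNIV (\<lambda>t. G x (cl t))"
      by (rule continuous_on_compose2 [OF contG [OF x]])
         (use cl in \<open>auto simp: cl_def intro!: continuous_intros\<close>)
    moreover have "bounded (G x ` {c..d})"
      by (intro compact_imp_bounded compact_continuous_image contG x) auto
    hence "bounded (range (\<lambda>t. G x (cl t)))"
      by (rule bounded_subset) (use cl in auto)
    ultimately show ?thesis by (simp add: bcontfun_def)
  qed
  define T :: "(real \<Rightarrow>\<^sub>C real) \<Rightarrow> (real \<Rightarrow>\<^sub>C real)"
    where "T x = Bcontfun (\<lambda>t. G (apply_bcontfun x) (cl t))" for x
  have T: "apply_bcontfun (T x) t = G x (cl t)" for x t
    unfolding T_def by (subst Bcontfun_inverse) (auto intro: bc)
  have contr: "dist (T x) (T y) \<le> L / K * dist x y" for x y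
  proof (rule dist_bound)
    fix t0
    define t where "t = cl t0"
    have t: "c \<le> t" "t \<le> d" using cl [of t0] by (auto simp: t_def)
    let ?F = "\<lambda>x s. F s (exp (K * (s - c)) * apply_bcontfun x s)"
    have int: "?F x integrable_on {c..t}" for x
      by (intro integrable_continuous_interval contF t) simp
    have "\<bar>integral {c..t} (?F x) - integral {c..t} (?F y)\<bar> = norm (integral {c..t} (\<lambda>s. ?F x s - ?F y s))"
      by (simp add: int Henstock_Kurzweil_Integration.integral_diff)
    also have "\<dots> \<le> integral {c..t} (\<lambda>s. L * dist x y * exp (K * (s - c)))"
    proof (rule integral_norm_bound_integral)
      fix s assume s: "s \<in> {c..t}"
      have "norm (?F x s - ?F y s) \<le> L * \<bar>exp (K * (s - c)) * x s - exp (K * (s - c)) * y s\<bar>"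
        using lip [of s] s t by simp
      also have "\<dots> = L * (exp (K * (s - c)) * dist (x s) (y s))"
        by (simp add: dist_real_def abs_mult flip: right_diff_distrib)
      also have "\<dots> \<le> L * (exp (K * (s - c)) * dist x y)"
        by (intro mult_left_mono dist_bounded L) auto
      finally show "norm (?F x s - ?F y s) \<le> L * dist x y * exp (K * (s - c))"
        by (simp add: mult_ac)
    next
      show "(\<lambda>s. ?F x s - ?F y s) integrable_on {c..t}"
        by (rule integrable_diff [OF int int])
      show "(\<lambda>s. L * dist x y * exp (K * (s - c))) integrable_on {c..t}"
        by (intro integrable_continuous_interval continuous_intros)
    qed
    also have "\<dots> = L * dist x y * ((exp (K * (t - c)) - 1) / K)"
      using has_integral_exp_scaled [of K c t] K t by (simp add: integral_unique)
    also have "\<dots> \<le> L * dist x y * (exp (K * (t - c)) / K)"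
      using K L by (intro mult_left_mono divide_right_mono) auto
    finally have *: "\<bar>integral {c..t} (?F x) - integral {c..t} (?F y)\<bar> \<le> L * dist x y * (exp (K * (t - c)) / K)" .
    have "dist (T x t0) (T y t0) = exp (- K * (t - c)) * \<bar>integral {c..t} (?F x) - integral {c..t} (?F y)\<bar>"
      by (simp add: T G_def t_def dist_real_def abs_mult flip: right_diff_distrib)
    also have "\<dots> \<le> exp (- K * (t - c)) * (L * dist x y * (exp (K * (t - c)) / K))"
      by (intro mult_left_mono *) auto
    also have "\<dots> = (exp (- K * (t - c)) * exp (K * (t - c))) * (L / K * dist x y)"
      by simp
    also have "exp (- K * (t - c)) * exp (K * (t - c)) = 1"
      by (simp flip: exp_add)
    finally show "dist (T x t0) (T y t0) \<le> L / K * dist x y" by simp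
  qed
  have "\<exists>!x. T x = x"
    using contr K L by (intro banach_fix_type [of "L / K"]) (auto simp: K_def)
  then obtain x where x: "T x = x" by blast
  define \<theta> where "\<theta> t = exp (K * (t - c)) * x t" for t
  have \<theta>: "\<theta> t = integral {c..t} (\<lambda>s. F s (\<theta> s))" if "t \<in> {c..d}" for t
  proof -
    have "cl t = t" using that by (auto simp: cl_def)
    hence "x t = G x t" using T [of x t] x by simp
    hence "\<theta> t = (exp (K * (t - c)) * exp (- K * (t - c))) * integral {c..t} (\<lambda>s. F s (\<theta> s))"
      by (simp add: \<theta>_def G_def)
    thus ?thesis by (simp flip: exp_add)
  qed
  show thesis
  proof
    show "\<theta> c = 0" using \<theta> [of c] cd by simp
    fix t assume t: "t \<in> {c..d}"
    have "((\<lambda>u. integral {c..u} (\<lambda>s. F s (\<theta> s))) has_real_derivative F t (\<theta> t)) (at t within {c..d})"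
      using contF [of x d] t unfolding \<theta>_def by (intro integral_has_real_derivative) auto
    thus "(\<theta> has_real_derivative F t (\<theta> t)) (at t within {c..d})"
      by (rule has_field_derivative_transform_within [OF _ zero_less_one t]) (simp add: \<theta>)
  qed
qed

text \<open>The integrating factor shows that exp(- K (s - c)) E s - D (s - c) is nonincreasing. The
  factor that it puts in front of \<open>D\<close> is at most one and is dropped, hence the linear
  term \<open>D * (t - c)\<close>.\<close>

lemma gronwall_affine:
  fixes E E' :: "real \<Rightarrow> real"
  assumes cont: "continuous_on {c..d} E" and E0: "E c = 0" and K: "K \<ge> 0" "D \<ge> 0"
    and der: "\<And>t. c < t \<Longrightarrow> t < d \<Longrightarrow> (E has_real_derivative E' t) (at t)"
    and le: "\<And>t. c < t \<Longrightarrow> t < d \<Longrightarrow> E' t \<le> K * E t + D"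
    and t: "t \<in> {c..d}"
  shows "E t \<le> D * (t - c) * exp (K * (t - c))"
proof -
  define G where "G s = exp (- K * (s - c)) * E s - D * (s - c)" for s
  have "G t \<le> G c"
  proof (rule DERIV_nonpos_imp_decreasing_open [of c t G])
    show "continuous_on {c..t} G"
      unfolding G_def using t by (intro continuous_intros continuous_on_subset [OF cont]) auto
    fix s assume s: "c < s" "s < t"
    have "(G has_real_derivative exp (- K * (s - c)) * (E' s - K * E s) - D) (at s)"
      unfolding G_def using s t
      by (auto intro!: derivative_eq_intros der simp: algebra_simps)
    moreover have "exp (- K * (s - c)) * (E' s - K * E s) \<le> exp (- K * (s - c)) * D"
      using le [of s] s t by (intro mult_left_mono) auto
    moreover have "exp (- K * (s - c)) * D \<le> 1 * D"
      using K s by (intro mult_right_mono) (auto simp: mult_le_0_iff)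
    ultimately show "\<exists>y. (G has_real_derivative y) (at s) \<and> y \<le> 0"
      by (intro exI [of _ "exp (- K * (s - c)) * (E' s - K * E s) - D"] conjI) linarith+
  qed (use t in auto)
  hence "exp (- K * (t - c)) * E t \<le> D * (t - c)"
    by (simp add: G_def E0)
  hence "exp (K * (t - c)) * (exp (- K * (t - c)) * E t) \<le> exp (K * (t - c)) * (D * (t - c))"
    by (rule mult_left_mono) auto
  also have "exp (K * (t - c)) * (exp (- K * (t - c)) * E t) = E t"
    by (simp flip: exp_add mult.assoc)
  finally show ?thesis by (simp add: mult_ac)
qed

text \<open>Just after \<open>c\<close> the function is positive, and at its first return to zero it
  would arrive from above, against the positive derivative there. Applied to the difference of two
  angles this acts as a comparison theorem.\<close>

lemma pos_of_upward_zeros: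
  fixes g g' :: "real \<Rightarrow> real"
  assumes der: "\<And>t. t \<in> {c..d} \<Longrightarrow> (g has_real_derivative g' t) (at t within {c..d})"
    and up: "\<And>t. t \<in> {c..d} \<Longrightarrow> g t = 0 \<Longrightarrow> g' t > 0"
    and t: "g c = 0" "c < t" "t \<le> d"
  shows "g t > 0"
proof (rule ccontr)
  assume neg: "\<not> g t > 0"
  have cont: "continuous_on {c..d} g"
    using der by (meson DERIV_continuous_on)
  have "c \<in> {c..d}" using t by simp
  from has_real_derivative_pos_inc_right [OF der [OF this] up [OF this t(1)]] t(1)
  obtain \<delta> where \<delta>: "\<delta> > 0" "\<And>h. h > 0 \<Longrightarrow> c + h \<in> {c..d} \<Longrightarrow> h < \<delta> \<Longrightarrow> 0 < g (c + h)" by auto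
  \<comment> \<open>Halving both distances keeps \<open>u\<close> inside the region where
    \<open>g\<close> is known to be positive and strictly before \<open>t\<close>.\<close>
  define u where "u = c + min (\<delta> / 2) ((t - c) / 2)"
  have u: "g s > 0" if "c < s" "s \<le> u" for s
  proof -
    have "s \<le> c + \<delta> / 2" "s \<le> c + (t - c) / 2"
      using that by (auto simp: u_def)
    moreover have "s - c < \<delta>" "s \<le> d"
      using calculation \<delta>(1) t by (auto simp: field_simps)
    ultimately show ?thesis
      using \<delta>(2) [of "s - c"] that by simp
  qed
  have u': "c < u" "u < t"
    using \<delta>(1) t by (auto simp: u_def min_def field_simps)
  define Z where "Z = {s \<in> {u..t}. g s \<le> 0}"
  have "closed Z"
    unfolding Z_def
    by (intro continuous_on_closed_Collect_le continuous_on_subset [OF cont]) (use u' t in auto)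
  moreover have "t \<in> Z" "bdd_below Z"
    using neg u' by (auto simp: Z_def)
  ultimately have s: "Inf Z \<in> Z"
    by (intro closed_contains_Inf) auto
  define s where "s = Inf Z"
  have s': "u < s" "s \<le> t" "g s \<le> 0"
    using s u [of u] u' by (auto simp: Z_def s_def less_le)
  have below: "g r > 0" if "u \<le> r" "r < s" for r
  proof (rule ccontr)
    assume "\<not> g r > 0"
    hence "r \<in> Z" using that s' by (auto simp: Z_def)
    hence "s \<le> r" unfolding s_def using \<open>bdd_below Z\<close> by (rule cInf_lower)
    thus False using that by simp
  qed
  have "s \<in> {c..d}" using s' u' t by auto
  have "g s \<ge> 0"
  proof (rule ccontr)
    assume "\<not> g s \<ge> 0"
    hence "\<exists>r\<ge>u. r \<le> s \<and> g r = 0"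
      using below [of u] s' u' t
      by (intro IVT2') (auto intro!: continuous_on_subset [OF cont])
    then obtain r where "u \<le> r" "r \<le> s" "g r = 0" by blast
    thus False using below [of r] \<open>\<not> g s \<ge> 0\<close> by (cases "r = s") auto
  qed
  hence "g s = 0" using s' by simp
  from has_real_derivative_pos_inc_left [OF der [OF \<open>s \<in> {c..d}\<close>] up [OF \<open>s \<in> {c..d}\<close> this]] this
  obtain \<epsilon> where \<epsilon>: "\<epsilon> > 0" "\<And>h. h > 0 \<Longrightarrow> s - h \<in> {c..d} \<Longrightarrow> h < \<epsilon> \<Longrightarrow> g (s - h) < 0" by auto
  define h where "h = min (\<epsilon> / 2) (s - u)"
  have "h > 0" "h < \<epsilon>" "u \<le> s - h" "s - h < s"
    using \<epsilon>(1) s' by (auto simp: h_def min_def)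
  thus False
    using \<epsilon>(2) [of h] below [of "s - h"] s' u' t by auto
qed

text \<open>Since \<open>g\<close> is continuous, \<open>f\<close> is an indefinite integral of it
  and thus differentiable up to the ends. This upgrades eigenfunctions, which are differentiated in
  the open interval only, to the closed interval on which the system is posed.\<close>

lemma DERIV_within_Icc_if_interior:
  fixes f g :: "real \<Rightarrow> real"
  assumes f: "continuous_on {c..d} f" and g: "continuous_on {c..d} g"
    and der: "\<And>t. c < t \<Longrightarrow> t < d \<Longrightarrow> (f has_real_derivative g t) (at t)"
    and t: "t \<in> {c..d}"
  shows "(f has_real_derivative g t) (at t within {c..d})"
proof -
  have ftc: "f c + integral {c..u} g = f u" if "u \<in> {c..d}" for u
  proof -
    have "(g has_integral f u - f c) {c..u}"
      using that der
      by (intro fundamental_theorem_of_calculus_interior continuous_on_subset [OF f])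
         (auto simp flip: has_real_derivative_iff_has_vector_derivative)
    thus ?thesis by (simp add: integral_unique)
  qed
  have "((\<lambda>u. f c + integral {c..u} g) has_real_derivative g t) (at t within {c..d})"
    using DERIV_add [OF DERIV_const integral_has_real_derivative [OF g t]] by simp
  thus ?thesis
    by (rule has_field_derivative_transform_within [OF _ zero_less_one t]) (simp add: ftc)
qed

section \<open>The Pruefer angle\<close>

text \<open>The coefficients are kept independent: \<open>a\<close> drives the equation of the flux
  and \<open>b\<close> that of the solution itself. Only for the Dirichlet problem is
  \<open>b\<close> tied to \<open>a\<close> as a power.\<close>

locale half_linear =
  fixes p c d :: real and a b :: "real \<Rightarrow> real"
  assumes p: "p > 1" and cd: "c < d"
    and cont_a: "continuous_on {c..d} a" and cont_b: "continuous_on {c..d} b"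
    and a_pos: "\<And>t. t \<in> {c..d} \<Longrightarrow> a t > 0" and b_pos: "\<And>t. t \<in> {c..d} \<Longrightarrow> b t > 0"
begin

definition rate :: "real \<Rightarrow> real \<Rightarrow> real" where
  "rate t x = b t * (1 - \<bar>psin p x\<bar> powr p) + a t * \<bar>psin p x\<bar> powr p"

definition prufer_angle :: "real \<Rightarrow> (real \<Rightarrow> real) \<Rightarrow> bool" where
  "prufer_angle \<alpha> \<theta> \<longleftrightarrow> \<theta> c = 0 \<and>
     (\<forall>t\<in>{c..d}. (\<theta> has_real_derivative \<alpha> * rate t (\<theta> t)) (at t within {c..d}))"

text \<open>The choice is immaterial for nonnegative \<alpha>: all angles with the same parameter
  agree at \<open>d\<close>, as \<open>final_angle_eq\<close> shows.\<close>

definition final_angle :: "real \<Rightarrow> real" where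
  "final_angle \<alpha> = (SOME \<theta>. prufer_angle \<alpha> \<theta>) d"

lemma abs_psin_powr_le_1: "\<bar>psin p x\<bar> powr p \<le> 1"
  using psin_pcos_energy [OF p, of x] powr_ge_zero [of "\<bar>pcos p x\<bar>" "p / (p - 1)"] by linarith

text \<open>The rate is a convex combination of the two coefficients, with weights |sin_p|^p and its
  complement.\<close>

lemma rate_bounds:
  assumes "m \<le> a t" "m \<le> b t" "a t \<le> M" "b t \<le> M"
  shows "m \<le> rate t x" "rate t x \<le> M"
proof -
  let ?h = "\<bar>psin p x\<bar> powr p"
  have h: "0 \<le> ?h" "0 \<le> 1 - ?h" using abs_psin_powr_le_1 by auto
  have "m = m * (1 - ?h) + m * ?h" by (simp add: algebra_simps)
  also have "\<dots> \<le> rate t x"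
    unfolding rate_def using assms h by (intro add_mono mult_right_mono)
  finally show "m \<le> rate t x" .
  have "rate t x \<le> M * (1 - ?h) + M * ?h"
    unfolding rate_def using assms h by (intro add_mono mult_right_mono)
  also have "\<dots> = M" by (simp add: algebra_simps)
  finally show "rate t x \<le> M" .
qed

lemma rate_pos: "t \<in> {c..d} \<Longrightarrow> rate t x > 0"
  using rate_bounds(1) [of "min (a t) (b t)" t "max (a t) (b t)" x] a_pos [of t] b_pos [of t]
  by simp

lemma coeff_upper_bound:
  obtains M where "M > 0" "\<And>t. t \<in> {c..d} \<Longrightarrow> a t \<le> M" "\<And>t. t \<in> {c..d} \<Longrightarrow> b t \<le> M"
proof -
  have ne: "{c..d} \<noteq> {}" using cd by auto
  obtain ta where ta: "\<And>t. t \<in> {c..d} \<Longrightarrow> a t \<le> a ta"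
    using continuous_attains_sup [OF compact_Icc ne cont_a] by blast
  obtain tb where tb: "\<And>t. t \<in> {c..d} \<Longrightarrow> b t \<le> b tb"
    using continuous_attains_sup [OF compact_Icc ne cont_b] by blast
  show thesis
    by (rule that [of "max 1 (max (a ta) (b tb))"])
       (use ta tb in \<open>auto simp: le_max_iff_disj\<close>)
qed

lemma coeff_lower_bound:
  obtains m where "m > 0" "\<And>t. t \<in> {c..d} \<Longrightarrow> m \<le> a t" "\<And>t. t \<in> {c..d} \<Longrightarrow> m \<le> b t"
proof -
  have ne: "{c..d} \<noteq> {}" using cd by auto
  obtain ta where ta: "ta \<in> {c..d}" "\<And>t. t \<in> {c..d} \<Longrightarrow> a ta \<le> a t"
    using continuous_attains_inf [OF compact_Icc ne cont_a] by blast
  obtain tb where tb: "tb \<in> {c..d}" "\<And>t. t \<in> {c..d} \<Longrightarrow> b tb \<le> b t"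
    using continuous_attains_inf [OF compact_Icc ne cont_b] by blast
  show thesis
    by (rule that [of "min (a ta) (b tb)"])
       (use ta tb a_pos b_pos in \<open>auto simp: min_le_iff_disj\<close>)
qed

lemma rate_lipschitz:
  assumes "t \<in> {c..d}" "a t \<le> M" "b t \<le> M"
  shows "\<bar>rate t x - rate t y\<bar> \<le> M * p * \<bar>x - y\<bar>"
proof -
  have "rate t x - rate t y = (a t - b t) * (\<bar>psin p x\<bar> powr p - \<bar>psin p y\<bar> powr p)"
    by (simp add: rate_def algebra_simps)
  hence "\<bar>rate t x - rate t y\<bar> = \<bar>a t - b t\<bar> * \<bar>\<bar>psin p x\<bar> powr p - \<bar>psin p y\<bar> powr p\<bar>"
    by (simp add: abs_mult)
  \<comment> \<open>Both coefficients lie between \<open>0\<close> and \<open>M\<close>, so their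
    difference is at most \<open>M\<close> in absolute value.\<close>
  also have "\<dots> \<le> M * (p * \<bar>x - y\<bar>)"
    using assms a_pos [of t] b_pos [of t]
    by (intro mult_mono abs_psin_powr_lipschitz [OF p]) auto
  finally show ?thesis by simp
qed

lemma continuous_on_rate: "continuous_on ({c..d} \<times> UNIV) (\<lambda>(t, x). rate t x)"
proof -
  have h: "continuous_on A (\<lambda>x. \<bar>psin p x\<bar> powr p)" for A
    using DERIV_abs_psin_powr [OF p] by (meson DERIV_isCont continuous_at_imp_continuous_on)
  show ?thesis
    unfolding rate_def split_beta
    by (intro continuous_intros continuous_on_compose2 [OF cont_a] continuous_on_compose2 [OF cont_b]
        continuous_on_compose2 [OF h [of UNIV]]) auto
qed

section \<open>Existence of the angle and its dependence on the parameter\<close>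

lemma prufer_angle_exists: "\<exists>\<theta>. prufer_angle \<alpha> \<theta>"
proof -
  obtain M where M: "M > 0" "\<And>t. t \<in> {c..d} \<Longrightarrow> a t \<le> M" "\<And>t. t \<in> {c..d} \<Longrightarrow> b t \<le> M"
    by (rule coeff_upper_bound) blast
  obtain \<theta> where "\<theta> c = 0"
    "\<And>t. t \<in> {c..d} \<Longrightarrow> (\<theta> has_real_derivative \<alpha> * rate t (\<theta> t)) (at t within {c..d})"
  proof (rule picard_global_lipschitz [of c d "\<lambda>t x. \<alpha> * rate t x" "\<bar>\<alpha>\<bar> * (M * p)"])
    show "continuous_on ({c..d} \<times> UNIV) (\<lambda>(t, x). \<alpha> * rate t x)"
      using continuous_on_mult [OF continuous_on_const continuous_on_rate]
      by (simp add: case_prod_unfold)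
    show "\<bar>\<alpha> * rate t x - \<alpha> * rate t y\<bar> \<le> \<bar>\<alpha>\<bar> * (M * p) * \<bar>x - y\<bar>" if "t \<in> {c..d}" for t x y
      using mult_left_mono [OF rate_lipschitz [OF that M(2,3) [OF that], of x y], of "\<bar>\<alpha>\<bar>"]
      by (simp add: mult.assoc flip: right_diff_distrib abs_mult)
  qed (use cd in auto)
  thus ?thesis unfolding prufer_angle_def by blast
qed

lemma prufer_angle_continuous: "prufer_angle \<alpha> \<theta> \<Longrightarrow> continuous_on {c..d} \<theta>"
  unfolding prufer_angle_def by (rule DERIV_continuous_on) auto

lemma prufer_angle_interior:
  "prufer_angle \<alpha> \<theta> \<Longrightarrow> c < t \<Longrightarrow> t < d \<Longrightarrow> (\<theta> has_real_derivative \<alpha> * rate t (\<theta> t)) (at t)"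
  unfolding prufer_angle_def by (auto simp flip: at_within_Icc_at [of c t d])

text \<open>Gronwall's inequality for the square of the difference, which unlike its modulus is
  differentiable. The term with \<open>\<alpha> - \<beta>\<close> is split by
  \<open>2 * u * v \<le> u\<^sup>2 + v\<^sup>2\<close>, whence the summand \<open>1\<close> in the
  exponent. Equal parameters give uniqueness, different ones Lipschitz continuity of the final
  angle.\<close>

lemma prufer_angle_dependence:
  assumes \<theta>: "prufer_angle \<alpha> \<theta>" "prufer_angle \<beta> \<eta>"
    and M: "M > 0" "\<And>t. t \<in> {c..d} \<Longrightarrow> a t \<le> M" "\<And>t. t \<in> {c..d} \<Longrightarrow> b t \<le> M"
    and A: "0 \<le> \<alpha>" "\<alpha> \<le> A"
  shows "(\<theta> d - \<eta> d)\<^sup>2 \<le>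
    ((\<alpha> - \<beta>) * M)\<^sup>2 * (d - c) * exp ((2 * A * (M * p) + 1) * (d - c))"
proof (rule gronwall_affine [where c = c and d = d and E = "\<lambda>t. (\<theta> t - \<eta> t)\<^sup>2"
    and E' = "\<lambda>t. 2 * (\<theta> t - \<eta> t) * (\<alpha> * rate t (\<theta> t) - \<beta> * rate t (\<eta> t))"])
  show "continuous_on {c..d} (\<lambda>t. (\<theta> t - \<eta> t)\<^sup>2)"
    by (intro continuous_intros prufer_angle_continuous [OF \<theta>(1)] prufer_angle_continuous [OF \<theta>(2)])
  show "(\<theta> c - \<eta> c)\<^sup>2 = 0"
    using \<theta> by (simp add: prufer_angle_def)
  show "0 \<le> 2 * A * (M * p) + 1"
    using M A p by simp
  fix t assume t: "c < t" "t < d"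
  show "((\<lambda>t. (\<theta> t - \<eta> t)\<^sup>2) has_real_derivative
      2 * (\<theta> t - \<eta> t) * (\<alpha> * rate t (\<theta> t) - \<beta> * rate t (\<eta> t))) (at t)"
    by (auto intro!: derivative_eq_intros prufer_angle_interior [OF \<theta>(1) t] prufer_angle_interior [OF \<theta>(2) t])
  let ?x = "\<theta> t" and ?y = "\<eta> t"
  have tt: "t \<in> {c..d}" using t by simp
  have "2 * (?x - ?y) * (\<alpha> * rate t ?x - \<beta> * rate t ?y) =
      2 * \<alpha> * ((?x - ?y) * (rate t ?x - rate t ?y)) + 2 * (?x - ?y) * ((\<alpha> - \<beta>) * rate t ?y)"
    by (simp add: algebra_simps)
  also have "2 * \<alpha> * ((?x - ?y) * (rate t ?x - rate t ?y)) \<le> 2 * A * ((M * p) * (?x - ?y)\<^sup>2)"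
  proof -
    have "(?x - ?y) * (rate t ?x - rate t ?y) \<le> \<bar>?x - ?y\<bar> * \<bar>rate t ?x - rate t ?y\<bar>"
      by (simp flip: abs_mult)
    also have "\<dots> \<le> \<bar>?x - ?y\<bar> * ((M * p) * \<bar>?x - ?y\<bar>)"
      by (intro mult_left_mono rate_lipschitz M tt) auto
    also have "\<dots> = (M * p) * (?x - ?y)\<^sup>2"
      by (simp add: power2_eq_square)
    finally have "2 * \<alpha> * ((?x - ?y) * (rate t ?x - rate t ?y)) \<le> 2 * \<alpha> * ((M * p) * (?x - ?y)\<^sup>2)"
      using A by (intro mult_left_mono) auto
    also have "\<dots> \<le> 2 * A * ((M * p) * (?x - ?y)\<^sup>2)"
      using A M p by (intro mult_right_mono) auto
    finally show ?thesis .
  qed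
  also have "2 * (?x - ?y) * ((\<alpha> - \<beta>) * rate t ?y) \<le> (?x - ?y)\<^sup>2 + ((\<alpha> - \<beta>) * rate t ?y)\<^sup>2"
    using sum_squares_bound [of "?x - ?y" "(\<alpha> - \<beta>) * rate t ?y"] by simp
  also have "((\<alpha> - \<beta>) * rate t ?y)\<^sup>2 \<le> ((\<alpha> - \<beta>) * M)\<^sup>2"
    using rate_pos [OF tt, of ?y] rate_bounds(2) [of "min (a t) (b t)" t M ?y] M(2,3) [OF tt]
    by (auto simp: power_mult_distrib intro!: mult_left_mono power_mono)
  finally show "2 * (?x - ?y) * (\<alpha> * rate t ?x - \<beta> * rate t ?y) \<le>
      (2 * A * (M * p) + 1) * (?x - ?y)\<^sup>2 + ((\<alpha> - \<beta>) * M)\<^sup>2"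
    by (simp add: algebra_simps)
qed (use cd in auto)

lemma final_angle_eq:
  assumes "prufer_angle \<alpha> \<theta>" "\<alpha> \<ge> 0"
  shows "final_angle \<alpha> = \<theta> d"
proof -
  obtain M where M: "M > 0" "\<And>t. t \<in> {c..d} \<Longrightarrow> a t \<le> M" "\<And>t. t \<in> {c..d} \<Longrightarrow> b t \<le> M"
    by (rule coeff_upper_bound) blast
  have "prufer_angle \<alpha> (SOME \<theta>. prufer_angle \<alpha> \<theta>)"
    using prufer_angle_exists by (rule someI_ex)
  from prufer_angle_dependence [OF assms(1) this M assms(2) order_refl] show ?thesis
    by (simp add: final_angle_def)
qed

lemma final_angle_witness:
  obtains \<theta> where "prufer_angle \<alpha> \<theta>" "\<theta> d = final_angle \<alpha>"
  using someI_ex [OF prufer_angle_exists [of \<alpha>]] unfolding final_angle_def by blast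

text \<open>Wherever the two angles meet, their derivatives differ by
  \<open>(\<beta> - \<alpha>) * rate t (\<theta> t)\<close>, which is positive; so the faster angle
  stays ahead after \<open>c\<close>.\<close>

lemma final_angle_strict_mono:
  assumes "0 \<le> \<alpha>" "\<alpha> < \<beta>"
  shows "final_angle \<alpha> < final_angle \<beta>"
proof -
  obtain \<theta> where \<theta>: "prufer_angle \<alpha> \<theta>" "\<theta> d = final_angle \<alpha>" by (rule final_angle_witness)
  obtain \<eta> where \<eta>: "prufer_angle \<beta> \<eta>" "\<eta> d = final_angle \<beta>" by (rule final_angle_witness)
  have "0 < \<eta> d - \<theta> d"
  proof (rule pos_of_upward_zeros [where c = c and d = d and g = "\<lambda>t. \<eta> t - \<theta> t"
      and g' = "\<lambda>t. \<beta> * rate t (\<eta> t) - \<alpha> * rate t (\<theta> t)"])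
    fix t assume t: "t \<in> {c..d}"
    show "((\<lambda>t. \<eta> t - \<theta> t) has_real_derivative \<beta> * rate t (\<eta> t) - \<alpha> * rate t (\<theta> t)) (at t within {c..d})"
      using \<theta>(1) \<eta>(1) t unfolding prufer_angle_def by (intro DERIV_diff) auto
    assume "\<eta> t - \<theta> t = 0"
    hence "\<beta> * rate t (\<eta> t) - \<alpha> * rate t (\<theta> t) = (\<beta> - \<alpha>) * rate t (\<theta> t)"
      by (simp add: algebra_simps)
    thus "\<beta> * rate t (\<eta> t) - \<alpha> * rate t (\<theta> t) > 0"
      using assms rate_pos [OF t] by simp
  qed (use \<theta> \<eta> cd in \<open>auto simp: prufer_angle_def\<close>)
  thus ?thesis using \<theta> \<eta> by simp
qed

text \<open>By the mean value theorem the final angle is \<open>\<alpha> * (d - c)\<close> times one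
  value of the rate.\<close>

lemma final_angle_bounds:
  assumes \<alpha>: "\<alpha> \<ge> 0"
    and m: "\<And>t. t \<in> {c..d} \<Longrightarrow> m \<le> a t" "\<And>t. t \<in> {c..d} \<Longrightarrow> m \<le> b t"
    and M: "\<And>t. t \<in> {c..d} \<Longrightarrow> a t \<le> M" "\<And>t. t \<in> {c..d} \<Longrightarrow> b t \<le> M"
  shows "\<alpha> * m * (d - c) \<le> final_angle \<alpha>" "final_angle \<alpha> \<le> \<alpha> * M * (d - c)"
proof -
  obtain \<theta> where \<theta>: "prufer_angle \<alpha> \<theta>" "\<theta> d = final_angle \<alpha>" by (rule final_angle_witness)
  obtain l s where s: "c < s" "s < d" "(\<theta> has_real_derivative l) (at s)" "\<theta> d - \<theta> c = (d - c) * l"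
    using MVT [OF cd prufer_angle_continuous [OF \<theta>(1)]] prufer_angle_interior [OF \<theta>(1)]
      real_differentiable_def by blast
  have "l = \<alpha> * rate s (\<theta> s)"
    using DERIV_unique [OF s(3) prufer_angle_interior [OF \<theta>(1) s(1,2)]] .
  hence eq: "final_angle \<alpha> = \<alpha> * rate s (\<theta> s) * (d - c)"
    using s(4) \<theta> by (simp add: prufer_angle_def)
  have "m \<le> rate s (\<theta> s)" "rate s (\<theta> s) \<le> M"
    using rate_bounds [of m s M "\<theta> s"] m M s by auto
  thus "\<alpha> * m * (d - c) \<le> final_angle \<alpha>" "final_angle \<alpha> \<le> \<alpha> * M * (d - c)"
    unfolding eq using \<alpha> cd by (auto intro!: mult_right_mono mult_left_mono)
qed

lemma final_angle_0 [simp]: "final_angle 0 = 0"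
  using final_angle_eq [of 0 "\<lambda>_. 0"] by (simp add: prufer_angle_def)

lemma continuous_on_final_angle: "continuous_on {0..A} final_angle"
proof -
  obtain M where M: "M > 0" "\<And>t. t \<in> {c..d} \<Longrightarrow> a t \<le> M" "\<And>t. t \<in> {c..d} \<Longrightarrow> b t \<le> M"
    by (rule coeff_upper_bound) blast
  define C where "C = M\<^sup>2 * (d - c) * exp ((2 * A * (M * p) + 1) * (d - c))"
  have C: "C \<ge> 0" using cd by (simp add: C_def)
  have "(sqrt C)-lipschitz_on {0..A} final_angle"
  proof (rule lipschitz_onI)
    fix \<alpha> \<beta> assume \<alpha>\<beta>: "\<alpha> \<in> {0..A}" "\<beta> \<in> {0..A}"
    obtain \<theta> where \<theta>: "prufer_angle \<alpha> \<theta>" "\<theta> d = final_angle \<alpha>" by (rule final_angle_witness)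
    obtain \<eta> where \<eta>: "prufer_angle \<beta> \<eta>" "\<eta> d = final_angle \<beta>" by (rule final_angle_witness)
    have "(final_angle \<alpha> - final_angle \<beta>)\<^sup>2 \<le> C * (\<alpha> - \<beta>)\<^sup>2"
      using prufer_angle_dependence [OF \<theta>(1) \<eta>(1) M, of A] \<alpha>\<beta> \<theta> \<eta>
      by (simp add: C_def power_mult_distrib mult_ac)
    hence "sqrt ((final_angle \<alpha> - final_angle \<beta>)\<^sup>2) \<le> sqrt (C * (\<alpha> - \<beta>)\<^sup>2)"
      by (rule real_sqrt_le_mono)
    thus "dist (final_angle \<alpha>) (final_angle \<beta>) \<le> sqrt C * dist \<alpha> \<beta>"
      by (simp add: real_sqrt_mult dist_real_def)
  qed (use C in simp)
  thus ?thesis by (rule lipschitz_on_continuous_on)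
qed

lemma final_angle_attains:
  assumes "x > 0"
  obtains \<alpha> where "\<alpha> > 0" "final_angle \<alpha> = x"
proof -
  obtain M where M: "M > 0" "\<And>t. t \<in> {c..d} \<Longrightarrow> a t \<le> M" "\<And>t. t \<in> {c..d} \<Longrightarrow> b t \<le> M"
    by (rule coeff_upper_bound) blast
  obtain m where m: "m > 0" "\<And>t. t \<in> {c..d} \<Longrightarrow> m \<le> a t" "\<And>t. t \<in> {c..d} \<Longrightarrow> m \<le> b t"
    by (rule coeff_lower_bound) blast
  \<comment> \<open>At this parameter the lower bound for the final angle is exactly
    \<open>x\<close>.\<close>
  define A where "A = x / (m * (d - c))"
  have A: "A > 0" using assms m cd by (simp add: A_def)
  have "x \<le> final_angle A"
    using final_angle_bounds(1) [OF less_imp_le [OF A] m(2,3) M(2,3)] m cd by (simp add: A_def)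
  hence "\<exists>\<alpha>\<ge>0. \<alpha> \<le> A \<and> final_angle \<alpha> = x"
    using A assms by (intro IVT' continuous_on_final_angle) auto
  then obtain \<alpha> where "\<alpha> \<ge> 0" "final_angle \<alpha> = x" by blast
  thus thesis
    using that [of \<alpha>] assms by (cases "\<alpha> = 0") auto
qed

end

section \<open>The planar system and its eigenparameters\<close>

context half_linear
begin

text \<open>Once \<open>b\<close> is the power -1 / (p - 1) of \<open>a\<close>, the component
  \<open>z\<close> is the flux of \<open>y\<close> divided by \<alpha>^(p - 1). This scaling lets
  \<alpha> enter both equations linearly. At the two ends the derivatives are one-sided.\<close>

definition solves :: "real \<Rightarrow> (real \<Rightarrow> real) \<Rightarrow> (real \<Rightarrow> real) \<Rightarrow> bool" where
  "solves \<alpha> y z \<longleftrightarrow> (\<forall>t\<in>{c..d}.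
     (y has_real_derivative \<alpha> * b t * spow (1 / (p - 1)) (z t)) (at t within {c..d}) \<and>
     (z has_real_derivative - ((p - 1) * \<alpha> * a t * spow (p - 1) (y t))) (at t within {c..d}))"

definition eigenparameter :: "real \<Rightarrow> bool" where
  "eigenparameter \<alpha> \<longleftrightarrow> (\<exists>y z. solves \<alpha> y z \<and> y c = 0 \<and> y d = 0 \<and> (\<exists>t\<in>{c..d}. y t \<noteq> 0))"

lemma spow_mult_self_conj: "spow (1 / (p - 1)) x * x = \<bar>x\<bar> powr (p / (p - 1))"
proof -
  have "1 / (p - 1) + 1 = p / (p - 1)" using p by (simp add: field_simps)
  thus ?thesis by (simp only: spow_mult_self)
qed

text \<open>The radius \<open>exp I\<close> solves \<open>r' = \<rho> r\<close>; with it \<open>y = r S\<close> and \<open>z = r\<^sup>p\<^sup>-\<^sup>1 C\<close> solve the system.\<close>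

lemma solution_of_angle:
  assumes \<alpha>: "\<alpha> > 0" and \<theta>: "prufer_angle \<alpha> \<theta>" and end0: "psin p (\<theta> d) = 0"
  shows "eigenparameter \<alpha>"
proof -
  define S where "S t = psin p (\<theta> t)" for t
  define C where "C t = pcos p (\<theta> t)" for t
  \<comment> \<open>Forced by the ansatz. With \<psi> the signed power 1 / (p - 1), S' = \<alpha>
    \<psi>(C) (b - (b - a) |S|^p), whereas (r S)' must equal \<alpha> b \<psi>(C) r; the missing
    term \<alpha> (b - a) |S|^p \<psi>(C) has to be \<rho> S.\<close>
  define \<rho> where "\<rho> t = \<alpha> * (b t - a t) * spow (p - 1) (S t) * spow (1 / (p - 1)) (C t)" for t
  define I where "I t = integral {c..t} \<rho>" for t
  define y where "y t = exp (I t) * S t" for t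
  define z where "z t = exp ((p - 1) * I t) * C t" for t
  have \<theta>': "(\<theta> has_real_derivative \<alpha> * rate t (\<theta> t)) (at t within {c..d})" if "t \<in> {c..d}" for t
    using \<theta> that by (simp add: prufer_angle_def)
  have S': "(S has_real_derivative spow (1 / (p - 1)) (C t) * (\<alpha> * rate t (\<theta> t))) (at t within {c..d})"
    and C': "(C has_real_derivative - (p - 1) * spow (p - 1) (S t) * (\<alpha> * rate t (\<theta> t))) (at t within {c..d})"
    if "t \<in> {c..d}" for t
    unfolding S_def [abs_def] C_def [abs_def]
    by (rule DERIV_chain2 [OF DERIV_psin [OF p] \<theta>' [OF that]]
        DERIV_chain2 [OF DERIV_pcos [OF p] \<theta>' [OF that]])+
  have "continuous_on {c..d} S" "continuous_on {c..d} C"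
    by (rule DERIV_continuous_on, erule S', rule DERIV_continuous_on, erule C')
  hence "continuous_on {c..d} \<rho>"
    unfolding \<rho>_def using p by (intro continuous_intros cont_a cont_b) auto
  hence I': "(I has_real_derivative \<rho> t) (at t within {c..d})" if "t \<in> {c..d}" for t
    unfolding I_def using that by (rule integral_has_real_derivative)
  have h: "spow (p - 1) (S t) * S t = \<bar>S t\<bar> powr p"
    "spow (1 / (p - 1)) (C t) * C t = 1 - \<bar>S t\<bar> powr p" for t
    using psin_pcos_energy [OF p, of "\<theta> t"] spow_mult_self [of "p - 1" "S t"]
    unfolding spow_mult_self_conj S_def C_def by auto
  have "solves \<alpha> y z"
    unfolding solves_def
  proof (intro ballI conjI)
    fix t assume t: "t \<in> {c..d}"
    have expI: "spow (p - 1) (exp (I t)) = exp ((p - 1) * I t)"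
      "spow (1 / (p - 1)) (exp ((p - 1) * I t)) = exp (I t)"
      using p by (auto simp: spow_def exp_powr_real mult.commute)
    have "(y has_real_derivative \<rho> t * exp (I t) * S t +
        spow (1 / (p - 1)) (C t) * (\<alpha> * rate t (\<theta> t)) * exp (I t)) (at t within {c..d})"
      unfolding y_def [abs_def]
      by (auto intro!: derivative_eq_intros I' S' t)
    also have "\<rho> t * exp (I t) * S t + spow (1 / (p - 1)) (C t) * (\<alpha> * rate t (\<theta> t)) * exp (I t) =
        \<alpha> * exp (I t) * spow (1 / (p - 1)) (C t) *
          ((b t - a t) * (spow (p - 1) (S t) * S t) + rate t (\<theta> t))"
      by (simp add: \<rho>_def algebra_simps)
    also have "\<dots> = \<alpha> * b t * spow (1 / (p - 1)) (z t)"
      unfolding h rate_def z_def spow_mult expI by (simp add: S_def algebra_simps)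
    finally show "(y has_real_derivative \<alpha> * b t * spow (1 / (p - 1)) (z t)) (at t within {c..d})" .
    have "(z has_real_derivative (p - 1) * \<rho> t * exp ((p - 1) * I t) * C t +
        - (p - 1) * spow (p - 1) (S t) * (\<alpha> * rate t (\<theta> t)) * exp ((p - 1) * I t)) (at t within {c..d})"
      unfolding z_def [abs_def]
      by (auto intro!: derivative_eq_intros I' C' t)
    also have "(p - 1) * \<rho> t * exp ((p - 1) * I t) * C t +
        - (p - 1) * spow (p - 1) (S t) * (\<alpha> * rate t (\<theta> t)) * exp ((p - 1) * I t) =
        (p - 1) * \<alpha> * exp ((p - 1) * I t) * spow (p - 1) (S t) *
          ((b t - a t) * (spow (1 / (p - 1)) (C t) * C t) - rate t (\<theta> t))"
      by (simp add: \<rho>_def algebra_simps)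
    also have "\<dots> = - ((p - 1) * \<alpha> * a t * spow (p - 1) (y t))"
      unfolding h rate_def y_def spow_mult expI by (simp add: S_def algebra_simps)
    finally show "(z has_real_derivative - ((p - 1) * \<alpha> * a t * spow (p - 1) (y t))) (at t within {c..d})" .
  qed
  moreover have "y c = 0" "y d = 0"
    using \<theta> p end0 by (auto simp: y_def S_def prufer_angle_def)
  \<comment> \<open>Nontriviality: \<open>y\<close> leaves zero with positive slope at
    \<open>c\<close> because \<open>z c = 1\<close>.\<close>
  moreover have "\<exists>t\<in>{c..d}. y t \<noteq> 0"
  proof -
    have c: "c \<in> {c..d}" using cd by simp
    have "z c = 1"
      using \<theta> p by (simp add: z_def I_def C_def prufer_angle_def)
    hence "\<alpha> * b c * spow (1 / (p - 1)) (z c) > 0"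
      using \<alpha> b_pos [OF c] by (simp add: spow_def)
    moreover have "(y has_real_derivative \<alpha> * b c * spow (1 / (p - 1)) (z c)) (at c within {c..d})"
      using \<open>solves \<alpha> y z\<close> c by (simp add: solves_def)
    ultimately obtain \<delta> where \<delta>: "\<delta> > 0" "\<And>h. h > 0 \<Longrightarrow> c + h \<in> {c..d} \<Longrightarrow> h < \<delta> \<Longrightarrow> y c < y (c + h)"
      using has_real_derivative_pos_inc_right by blast
    define h where "h = min (\<delta> / 2) (d - c)"
    have h: "h > 0" "h < \<delta>" "c + h \<in> {c..d}"
      using \<delta>(1) cd by (auto simp: h_def min_def)
    show ?thesis
      using \<delta>(2) [OF h(1,3,2)] \<open>y c = 0\<close> h(3) by (intro bexI [of _ "c + h"]) auto
  qed
  ultimately show ?thesis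
    unfolding eigenparameter_def by blast
qed

text \<open>The two contributions carry the same product of signed powers with opposite signs, so
  only \<open>b - a\<close> survives; equal coefficients would conserve the energy. The powers match
  because \<open>p / (p - 1) - 1 = 1 / (p - 1)\<close>.\<close>

lemma DERIV_energy:
  assumes "solves \<alpha> y z" "t \<in> {c..d}"
  shows "((\<lambda>t. \<bar>y t\<bar> powr p + \<bar>z t\<bar> powr (p / (p - 1))) has_real_derivative
    p * \<alpha> * (b t - a t) * (spow (p - 1) (y t) * spow (1 / (p - 1)) (z t))) (at t within {c..d})"
proof -
  have q: "p / (p - 1) > 1" "p / (p - 1) - 1 = 1 / (p - 1)"
    using p by (auto simp: field_simps)
  have "((\<lambda>t. \<bar>y t\<bar> powr p + \<bar>z t\<bar> powr (p / (p - 1))) has_real_derivative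
      p * spow (p - 1) (y t) * (\<alpha> * b t * spow (1 / (p - 1)) (z t)) +
      p / (p - 1) * spow (p / (p - 1) - 1) (z t) * - ((p - 1) * \<alpha> * a t * spow (p - 1) (y t))) (at t within {c..d})"
    using assms unfolding solves_def
    by (intro DERIV_add DERIV_chain2 [OF DERIV_abs_powr [OF p]] DERIV_chain2 [OF DERIV_abs_powr [OF q(1)]]) auto
  also have "p * spow (p - 1) (y t) * (\<alpha> * b t * spow (1 / (p - 1)) (z t)) +
      p / (p - 1) * spow (p / (p - 1) - 1) (z t) * - ((p - 1) * \<alpha> * a t * spow (p - 1) (y t)) =
      p * \<alpha> * (b t - a t) * (spow (p - 1) (y t) * spow (1 / (p - 1)) (z t))"
    unfolding q(2) using p by (simp add: divide_simps) (simp add: algebra_simps)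
  finally show ?thesis .
qed

lemma energy_derivative_bound:
  assumes "t \<in> {c..d}" "a t \<le> M" "b t \<le> M" "\<alpha> > 0"
  shows "\<bar>p * \<alpha> * (b t - a t) * (spow (p - 1) y * spow (1 / (p - 1)) z)\<bar> \<le>
    p * \<alpha> * M * (\<bar>y\<bar> powr p + \<bar>z\<bar> powr (p / (p - 1)))"
proof -
  have "\<bar>p * \<alpha> * (b t - a t)\<bar> * \<bar>spow (p - 1) y * spow (1 / (p - 1)) z\<bar> \<le>
      (p * \<alpha> * M) * (\<bar>y\<bar> powr p + \<bar>z\<bar> powr (p / (p - 1)))"
    using assms a_pos [of t] b_pos [of t] p
    by (intro mult_mono abs_spow_mult_spow_le) (auto simp: abs_mult)
  thus ?thesis by (simp only: abs_mult)
qed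

text \<open>The energy decays at most exponentially: E' \<ge> - K E makes exp(K (t - c)) E
  nondecreasing. Positivity is what permits division by the radius.\<close>

lemma energy_pos:
  assumes \<alpha>: "\<alpha> > 0" and sol: "solves \<alpha> y z" and "z c \<noteq> 0" and t: "t \<in> {c..d}"
  shows "\<bar>y t\<bar> powr p + \<bar>z t\<bar> powr (p / (p - 1)) > 0"
proof -
  let ?E = "\<lambda>t. \<bar>y t\<bar> powr p + \<bar>z t\<bar> powr (p / (p - 1))"
  let ?E' = "\<lambda>t. p * \<alpha> * (b t - a t) * (spow (p - 1) (y t) * spow (1 / (p - 1)) (z t))"
  obtain M where M: "M > 0" "\<And>t. t \<in> {c..d} \<Longrightarrow> a t \<le> M" "\<And>t. t \<in> {c..d} \<Longrightarrow> b t \<le> M"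
    by (rule coeff_upper_bound) blast
  define K where "K = p * \<alpha> * M"
  define G where "G s = exp (K * (s - c)) * ?E s" for s
  have "G c \<le> G t"
  proof (rule DERIV_nonneg_imp_increasing_open [of c t G])
    have "continuous_on {c..d} ?E"
      by (rule DERIV_continuous_on, erule DERIV_energy [OF sol])
    hence "continuous_on {c..t} ?E"
      by (rule continuous_on_subset) (use t in auto)
    thus "continuous_on {c..t} G"
      unfolding G_def by (rule continuous_on_mult [rotated]) (intro continuous_intros)
    fix s assume s: "c < s" "s < t"
    hence sd: "s \<in> {c..d}" "s < d" using t by auto
    have E': "(?E has_real_derivative ?E' s) (at s)"
      using DERIV_energy [OF sol sd(1)] at_within_Icc_at [OF s(1) sd(2)] by simp
    have "(G has_real_derivative exp (K * (s - c)) * (K * ?E s + ?E' s)) (at s)"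
      unfolding G_def
      by (rule derivative_eq_intros E' refl | simp add: algebra_simps)+
    moreover have "0 \<le> K * ?E s + ?E' s"
      using energy_derivative_bound [OF sd(1) M(2,3) [OF sd(1)] \<alpha>, of "y s" "z s"]
      unfolding K_def by linarith
    ultimately show "\<exists>l. (G has_real_derivative l) (at s) \<and> l \<ge> 0"
      by (intro exI [of _ "exp (K * (s - c)) * (K * ?E s + ?E' s)"] conjI mult_nonneg_nonneg) simp_all
  qed (use t in auto)
  moreover have "G c > 0"
    using \<open>z c \<noteq> 0\<close> by (auto simp: G_def intro!: add_nonneg_pos)
  ultimately have "exp (K * (t - c)) * ?E t > 0"
    by (simp add: G_def)
  thus ?thesis by (simp add: zero_less_mult_iff)
qed

text \<open>Gronwall with \<open>D = 0\<close> keeps the energy at zero: uniqueness for zero initial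
  data without a Lipschitz condition on the system.\<close>

lemma solves_trivial:
  assumes \<alpha>: "\<alpha> > 0" and sol: "solves \<alpha> y z" and init: "y c = 0" "z c = 0" and t: "t \<in> {c..d}"
  shows "y t = 0"
proof -
  let ?E = "\<lambda>t. \<bar>y t\<bar> powr p + \<bar>z t\<bar> powr (p / (p - 1))"
  let ?E' = "\<lambda>t. p * \<alpha> * (b t - a t) * (spow (p - 1) (y t) * spow (1 / (p - 1)) (z t))"
  obtain M where M: "M > 0" "\<And>t. t \<in> {c..d} \<Longrightarrow> a t \<le> M" "\<And>t. t \<in> {c..d} \<Longrightarrow> b t \<le> M"
    by (rule coeff_upper_bound) blast
  have "?E t \<le> 0 * (t - c) * exp (p * \<alpha> * M * (t - c))"
  proof (rule gronwall_affine [where c = c and d = d and E = ?E and E' = ?E'])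
    show "continuous_on {c..d} ?E"
      by (rule DERIV_continuous_on, erule DERIV_energy [OF sol])
    fix s assume s: "c < s" "s < d"
    hence sd: "s \<in> {c..d}" by auto
    show "(?E has_real_derivative ?E' s) (at s)"
      using DERIV_energy [OF sol sd] at_within_Icc_at [OF s] by simp
    show "?E' s \<le> p * \<alpha> * M * ?E s + 0"
      using energy_derivative_bound [OF sd M(2,3) [OF sd] \<alpha>, of "y s" "z s"] by linarith
  qed (use init p \<alpha> M t in auto)
  moreover have "\<bar>y t\<bar> powr p \<ge> 0" "\<bar>z t\<bar> powr (p / (p - 1)) \<ge> 0" by simp_all
  ultimately have "\<bar>y t\<bar> powr p = 0" by linarith
  thus ?thesis by simp
qed

text \<open>Dividing \<open>y\<close> by the radius \<open>r\<close>, the p-th root of the energy,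
  and \<open>z\<close> by \<open>r powr (p - 1)\<close> puts the solution on the curve |\<eta>|^p +
  |\<zeta>|^(p/(p-1)) = 1, where it lifts to a continuous angle. The radius never vanishes, so zeros
  of \<open>y\<close> are zeros of the generalised sine.\<close>

lemma angle_of_solution:
  assumes \<alpha>: "\<alpha> > 0" and sol: "solves \<alpha> y z" and init: "y c = 0" "z c > 0"
  obtains \<theta> where "prufer_angle \<alpha> \<theta>" "y d = 0 \<longleftrightarrow> psin p (\<theta> d) = 0"
proof -
  define E where "E t = \<bar>y t\<bar> powr p + \<bar>z t\<bar> powr (p / (p - 1))" for t
  define r where "r t = E t powr (1 / p)" for t
  define \<eta> where "\<eta> t = y t / r t" for t
  define \<zeta> where "\<zeta> t = z t / r t powr (p - 1)" for t
  \<comment> \<open>This will be the logarithmic derivative of \<open>r\<close>, the same expression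
    as in the converse construction.\<close>
  define \<rho> where "\<rho> t = \<alpha> * (b t - a t) * (spow (p - 1) (\<eta> t) * spow (1 / (p - 1)) (\<zeta> t))" for t
  have E: "E t > 0" if "t \<in> {c..d}" for t
    using energy_pos [OF \<alpha> sol _ that] init by (simp add: E_def)
  have r: "r t > 0" if "t \<in> {c..d}" for t
    using E [OF that] by (simp add: r_def)
  have r_powr: "r t powr p = E t" if "t \<in> {c..d}" for t
    using E [OF that] p by (simp add: r_def powr_powr)
  have yz: "y t = r t * \<eta> t" "z t = r t powr (p - 1) * \<zeta> t" if "t \<in> {c..d}" for t
    using r [OF that] by (simp_all add: \<eta>_def \<zeta>_def)
  have phi_y: "spow (p - 1) (y t) = r t powr (p - 1) * spow (p - 1) (\<eta> t)"
    and psi_z: "spow (1 / (p - 1)) (z t) = r t * spow (1 / (p - 1)) (\<zeta> t)" if "t \<in> {c..d}" for t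
    using r [OF that] p by (simp_all add: yz [OF that] spow_mult spow_of_pos powr_powr)
  have curve: "\<bar>\<eta> t\<bar> powr p + \<bar>\<zeta> t\<bar> powr (p / (p - 1)) = 1" if t: "t \<in> {c..d}" for t
  proof -
    have "\<bar>\<eta> t\<bar> powr p = \<bar>y t\<bar> powr p / E t"
      using r [OF t] by (simp add: \<eta>_def powr_divide r_powr [OF t])
    moreover have "\<bar>\<zeta> t\<bar> powr (p / (p - 1)) = \<bar>z t\<bar> powr (p / (p - 1)) / E t"
      using r [OF t] p by (simp add: \<zeta>_def powr_divide powr_powr r_powr [OF t])
    ultimately show ?thesis
      using E [OF t] by (simp add: E_def flip: add_divide_distrib)
  qed
  have r': "(r has_real_derivative \<rho> t * r t) (at t within {c..d})" if t: "t \<in> {c..d}" for t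
  proof -
    let ?E' = "p * \<alpha> * (b t - a t) * (spow (p - 1) (y t) * spow (1 / (p - 1)) (z t))"
    have "(E has_real_derivative ?E') (at t within {c..d})"
      unfolding E_def [abs_def] by (rule DERIV_energy [OF sol t])
    hence "(r has_real_derivative (1 / p) * E t powr (1 / p - 1) * ?E') (at t within {c..d})"
      unfolding r_def [abs_def] using E [OF t] by (intro DERIV_chain2 [OF has_real_derivative_powr])
    also have "?E' = p * \<rho> t * (r t powr (p - 1) * r t)"
      by (simp add: phi_y [OF t] psi_z [OF t] \<rho>_def mult_ac)
    also have "r t powr (p - 1) * r t = E t"
      using r [OF t] r_powr [OF t] by (simp add: powr_diff)
    also have "(1 / p) * E t powr (1 / p - 1) * (p * \<rho> t * E t) = \<rho> t * (E t powr (1 / p - 1) * E t)"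
      using p by simp
    also have "E t powr (1 / p - 1) * E t = r t"
      using E [OF t] by (simp add: powr_diff r_def)
    finally show ?thesis .
  qed
  have rp': "((\<lambda>t. r t powr (p - 1)) has_real_derivative (p - 1) * \<rho> t * r t powr (p - 1)) (at t within {c..d})"
    if t: "t \<in> {c..d}" for t
  proof -
    have "((\<lambda>t. r t powr (p - 1)) has_real_derivative
        (p - 1) * r t powr (p - 1 - 1) * (\<rho> t * r t)) (at t within {c..d})"
      using r [OF t] by (intro DERIV_chain2 [OF has_real_derivative_powr] r' t)
    also have "(p - 1) * r t powr (p - 1 - 1) * (\<rho> t * r t) = (p - 1) * \<rho> t * (r t powr (p - 1 - 1) * r t)"
      by simp
    also have "r t powr (p - 1 - 1) * r t = r t powr (p - 1)"
      unfolding powr_diff [of _ "p - 1" 1] using r [OF t] by simp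
    finally show ?thesis .
  qed
  define v where "v t = b t * (1 - \<bar>\<eta> t\<bar> powr p) + a t * \<bar>\<eta> t\<bar> powr p" for t
  have h: "spow (p - 1) (\<eta> t) * \<eta> t = \<bar>\<eta> t\<bar> powr p"
    "spow (1 / (p - 1)) (\<zeta> t) * \<zeta> t = 1 - \<bar>\<eta> t\<bar> powr p" if "t \<in> {c..d}" for t
    using curve [OF that] spow_mult_self [of "p - 1" "\<eta> t"] unfolding spow_mult_self_conj by auto
  have \<eta>': "(\<eta> has_real_derivative spow (1 / (p - 1)) (\<zeta> t) * (\<alpha> * v t)) (at t within {c..d})"
    if t: "t \<in> {c..d}" for t
  proof -
    have "(\<eta> has_real_derivative
        (\<alpha> * b t * spow (1 / (p - 1)) (z t) * r t - y t * (\<rho> t * r t)) / (r t * r t)) (at t within {c..d})"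
      unfolding \<eta>_def [abs_def] using sol t r [OF t]
      by (intro DERIV_divide r') (auto simp: solves_def)
    also have "(\<alpha> * b t * spow (1 / (p - 1)) (z t) * r t - y t * (\<rho> t * r t)) / (r t * r t) =
        \<alpha> * b t * spow (1 / (p - 1)) (\<zeta> t) - \<rho> t * \<eta> t"
      unfolding psi_z [OF t] yz(1) [OF t] using r [OF t] by (simp add: field_simps)
    also have "\<rho> t * \<eta> t = \<alpha> * (b t - a t) * (spow (p - 1) (\<eta> t) * \<eta> t) * spow (1 / (p - 1)) (\<zeta> t)"
      by (simp add: \<rho>_def)
    also have "\<alpha> * b t * spow (1 / (p - 1)) (\<zeta> t) - \<dots> = spow (1 / (p - 1)) (\<zeta> t) * (\<alpha> * v t)"
      unfolding h [OF t] v_def by (simp add: algebra_simps)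
    finally show ?thesis .
  qed
  have \<zeta>': "(\<zeta> has_real_derivative - (p - 1) * spow (p - 1) (\<eta> t) * (\<alpha> * v t)) (at t within {c..d})"
    if t: "t \<in> {c..d}" for t
  proof -
    have "(\<zeta> has_real_derivative
        (- ((p - 1) * \<alpha> * a t * spow (p - 1) (y t)) * r t powr (p - 1) - z t * ((p - 1) * \<rho> t * r t powr (p - 1))) /
        (r t powr (p - 1) * r t powr (p - 1))) (at t within {c..d})"
      unfolding \<zeta>_def [abs_def] using sol t r [OF t]
      by (intro DERIV_divide rp') (auto simp: solves_def)
    also have "(- ((p - 1) * \<alpha> * a t * spow (p - 1) (y t)) * r t powr (p - 1) - z t * ((p - 1) * \<rho> t * r t powr (p - 1))) /
        (r t powr (p - 1) * r t powr (p - 1)) = - ((p - 1) * (\<alpha> * a t * spow (p - 1) (\<eta> t) + \<rho> t * \<zeta> t))"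
    proof -
      have "(- ((p - 1) * \<alpha> * a t * (w * x)) * w - (w * x') * ((p - 1) * k * w)) / (w * w) =
          - ((p - 1) * (\<alpha> * a t * x + k * x'))" if "w > 0" for w x x' k
        using that by (simp add: divide_simps) (simp add: algebra_simps)
      thus ?thesis
        unfolding phi_y [OF t] yz(2) [OF t] using r [OF t] by simp
    qed
    also have "\<rho> t * \<zeta> t = \<alpha> * (b t - a t) * spow (p - 1) (\<eta> t) * (spow (1 / (p - 1)) (\<zeta> t) * \<zeta> t)"
      by (simp add: \<rho>_def)
    also have "- ((p - 1) * (\<alpha> * a t * spow (p - 1) (\<eta> t) + \<dots>)) = - (p - 1) * spow (p - 1) (\<eta> t) * (\<alpha> * v t)"
      unfolding h [OF t] v_def by (simp add: algebra_simps)
    finally show ?thesis .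
  qed
  have cont: "continuous_on {c..d} \<eta>" "continuous_on {c..d} \<zeta>"
    by (rule DERIV_continuous_on, erule \<eta>', rule DERIV_continuous_on, erule \<zeta>')
  have c: "c \<in> {c..d}" using cd by simp
  obtain \<theta> where \<theta>: "continuous_on {c..d} \<theta>" "\<theta> c = 0"
    "\<And>t. t \<in> {c..d} \<Longrightarrow> psin p (\<theta> t) = \<eta> t \<and> pcos p (\<theta> t) = \<zeta> t"
    using psin_pcos_lift [OF p cont curve less_imp_le [OF cd]] init r [OF c]
    by (auto simp: \<eta>_def \<zeta>_def)
  have "prufer_angle \<alpha> \<theta>"
    unfolding prufer_angle_def
  proof (intro conjI ballI)
    fix t assume t: "t \<in> {c..d}"
    have \<theta>t: "continuous (at t within {c..d}) \<theta>"
      using \<theta>(1) t by (simp add: continuous_on_eq_continuous_within)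
    have v: "v t = rate t (\<theta> t)"
      using \<theta>(3) [OF t] by (simp add: v_def rate_def)
    have comp: "((\<lambda>s. psin p (\<theta> s)) has_real_derivative spow (1 / (p - 1)) (\<zeta> t) * (\<alpha> * v t)) (at t within {c..d})"
      "((\<lambda>s. pcos p (\<theta> s)) has_real_derivative - (p - 1) * spow (p - 1) (\<eta> t) * (\<alpha> * v t)) (at t within {c..d})"
      by (rule has_field_derivative_transform_within [OF \<eta>' [OF t] zero_less_one t]
          has_field_derivative_transform_within [OF \<zeta>' [OF t] zero_less_one t], simp add: \<theta>(3))+
    show "(\<theta> has_real_derivative \<alpha> * rate t (\<theta> t)) (at t within {c..d})"
    \<comment> \<open>The derivatives of \<open>psin\<close> and \<open>pcos\<close> do not vanish
      together: where the cosine component is zero, the curve makes the sine component nonzero, and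
      \<open>pcos\<close> is used to recover the derivative of the angle.\<close>
    proof (cases "\<zeta> t = 0")
      case False
      thus ?thesis
        using DERIV_cancel_outer [OF DERIV_psin [OF p] _ \<theta>t comp(1)] \<theta>(3) [OF t] by (simp add: v)
    next
      case True
      hence "\<eta> t \<noteq> 0" using curve [OF t] p by auto
      thus ?thesis
        using DERIV_cancel_outer [OF DERIV_pcos [OF p] _ \<theta>t comp(2)] \<theta>(3) [OF t] p by (simp add: v)
    qed
  qed fact
  moreover have "d \<in> {c..d}" using cd by simp
  hence "y d = 0 \<longleftrightarrow> psin p (\<theta> d) = 0"
    using \<theta>(3) [of d] r [of d] by (simp add: \<eta>_def)
  ultimately show thesis by (rule that)
qed

lemma eigenparameter_iff:
  assumes \<alpha>: "\<alpha> > 0"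
  shows "eigenparameter \<alpha> \<longleftrightarrow> (\<exists>n\<ge>1. final_angle \<alpha> = real n * half_period p)"
proof
  assume "eigenparameter \<alpha>"
  then obtain y0 z0 where 0: "solves \<alpha> y0 z0" "y0 c = 0" "y0 d = 0" "\<exists>t\<in>{c..d}. y0 t \<noteq> 0"
    unfolding eigenparameter_def by blast
  have "z0 c \<noteq> 0"
    using solves_trivial [OF \<alpha> 0(1,2)] 0(4) by blast
  \<comment> \<open>The system is odd, so changing the sign of both components makes
    \<open>z c\<close> positive.\<close>
  obtain y z where yz: "solves \<alpha> y z" "y c = 0" "y d = 0" "z c > 0"
  proof (cases "z0 c > 0")
    case True
    thus thesis using that 0 by blast
  next
    case False
    have "solves \<alpha> (\<lambda>t. - y0 t) (\<lambda>t. - z0 t)"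
      using 0(1) unfolding solves_def by (auto intro!: derivative_eq_intros)
    thus thesis using that [of "\<lambda>t. - y0 t" "\<lambda>t. - z0 t"] 0 False \<open>z0 c \<noteq> 0\<close> by simp
  qed
  obtain \<theta> where \<theta>: "prufer_angle \<alpha> \<theta>" "psin p (\<theta> d) = 0"
    using angle_of_solution [OF \<alpha> yz(1,2,4)] yz(3) by blast
  have eq: "final_angle \<alpha> = \<theta> d"
    using final_angle_eq [OF \<theta>(1)] \<alpha> by simp
  \<comment> \<open>Positivity excludes the multiple zero of the half period.\<close>
  moreover have "final_angle \<alpha> > 0"
    using final_angle_strict_mono [of 0 \<alpha>] \<alpha> by simp
  ultimately show "\<exists>n\<ge>1. final_angle \<alpha> = real n * half_period p"
    using psin_eq_0_imp [OF p \<theta>(2)] by metis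
next
  assume "\<exists>n\<ge>1. final_angle \<alpha> = real n * half_period p"
  then obtain n where n: "final_angle \<alpha> = real n * half_period p" by blast
  obtain \<theta> where \<theta>: "prufer_angle \<alpha> \<theta>" "\<theta> d = final_angle \<alpha>" by (rule final_angle_witness)
  show "eigenparameter \<alpha>"
    using solution_of_angle [OF \<alpha> \<theta>(1)] \<theta>(2) n psin_nat_half_period [OF p, of n] by simp
qed

end

section \<open>The Dirichlet spectrum on an interval\<close>

text \<open>The one-dimensional problem with weight \<open>a\<close>. As in the radial definition,
  the flux \<open>a s * phi p (w' s)\<close> is differentiated rather than \<open>w'\<close> itself,
  and only in the open interval.\<close>

definition dirichlet_eigenvalues :: "real \<Rightarrow> real \<Rightarrow> real \<Rightarrow> (real \<Rightarrow> real) \<Rightarrow> real set" where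
  "dirichlet_eigenvalues p c d a = {l. \<exists>w w' :: real \<Rightarrow> real.
     continuous_on {c..d} w \<and> w c = 0 \<and> w d = 0 \<and> (\<exists>t\<in>{c<..<d}. w t \<noteq> 0) \<and>
     (\<forall>t\<in>{c<..<d}. (w has_real_derivative w' t) (at t) \<and>
        ((\<lambda>s. a s * phi p (w' s)) has_real_derivative - (l * (a t * phi p (w t)))) (at t))}"

locale dirichlet =
  fixes p c d :: real and a :: "real \<Rightarrow> real"
  assumes p: "p > 1" and cd: "c < d" and cont: "continuous_on {c..d} a"
    and pos: "\<And>t. t \<in> {c..d} \<Longrightarrow> a t > 0"
begin

text \<open>The power for which the flux relation \<open>z = a * spow (p - 1) w'\<close> is inverted
  by \<open>w' = b * spow (1 / (p - 1)) z\<close>.\<close>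

abbreviation b :: "real \<Rightarrow> real" where
  "b t \<equiv> a t powr - (1 / (p - 1))"

sublocale half_linear p c d a b
proof
  show "continuous_on {c..d} b"
    using pos by (intro continuous_intros cont) force
  show "b t > 0" if "t \<in> {c..d}" for t
    using pos [OF that] by simp
qed (use p cd cont pos in auto)

text \<open>The derivative of the flux extends continuously to the closed interval, so the flux is
  an indefinite integral up to a constant and extends too; with it \<open>w'\<close> extends
  continuously to the ends.\<close>

lemma normal_form:
  assumes l: "l \<in> dirichlet_eigenvalues p c d a"
  obtains w z where "w c = 0" "w d = 0" "\<exists>t\<in>{c<..<d}. w t \<noteq> 0"
    "\<And>t. t \<in> {c..d} \<Longrightarrow> (w has_real_derivative b t * spow (1 / (p - 1)) (z t)) (at t within {c..d})"
    "\<And>t. t \<in> {c..d} \<Longrightarrow> (z has_real_derivative - (l * (a t * spow (p - 1) (w t)))) (at t within {c..d})"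
proof -
  obtain w w' where w: "continuous_on {c..d} w" "w c = 0" "w d = 0" "\<exists>t\<in>{c<..<d}. w t \<noteq> 0"
    "\<And>t. t \<in> {c<..<d} \<Longrightarrow> (w has_real_derivative w' t) (at t)"
    "\<And>t. t \<in> {c<..<d} \<Longrightarrow>
      ((\<lambda>s. a s * spow (p - 1) (w' s)) has_real_derivative - (l * (a t * spow (p - 1) (w t)))) (at t)"
    using l unfolding dirichlet_eigenvalues_def phi_real by blast
  define g where "g t = - (l * (a t * spow (p - 1) (w t)))" for t
  have g: "continuous_on {c..d} g"
    unfolding g_def using p by (intro continuous_intros cont w) auto
  have "\<exists>k. \<forall>t\<in>{c<..<d}. integral {c..t} g - a t * spow (p - 1) (w' t) = k"
  proof (rule has_field_derivative_zero_constant)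
    fix t assume t: "t \<in> {c<..<d}"
    have "((\<lambda>t. integral {c..t} g) has_real_derivative g t) (at t)"
      using integral_has_real_derivative [OF g, of t] t at_within_Icc_at [of c t d] by simp
    hence "((\<lambda>t. integral {c..t} g - a t * spow (p - 1) (w' t)) has_real_derivative g t - g t) (at t)"
      using w(6) [OF t] unfolding g_def by (rule DERIV_diff)
    thus "((\<lambda>t. integral {c..t} g - a t * spow (p - 1) (w' t)) has_real_derivative 0) (at t within {c<..<d})"
      by (simp add: has_field_derivative_at_within)
  qed simp
  then obtain k where k: "\<And>t. t \<in> {c<..<d} \<Longrightarrow> integral {c..t} g - a t * spow (p - 1) (w' t) = k"
    by blast
  \<comment> \<open>Agrees with the flux in the open interval and is defined at the ends as
    well.\<close>
  define z where "z t = integral {c..t} g - k" for t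
  have z: "(z has_real_derivative g t) (at t within {c..d})" if "t \<in> {c..d}" for t
    unfolding z_def using DERIV_diff [OF integral_has_real_derivative [OF g that] DERIV_const] by simp
  hence "continuous_on {c..d} z"
    by (rule DERIV_continuous_on)
  hence bz: "continuous_on {c..d} (\<lambda>t. b t * spow (1 / (p - 1)) (z t))"
    using p by (intro continuous_intros cont_b) auto
  have w': "w' t = b t * spow (1 / (p - 1)) (z t)" if t: "t \<in> {c<..<d}" for t
  proof -
    have at: "a t > 0" using pos [of t] t by simp
    have "z t = a t * spow (p - 1) (w' t)"
      using k [OF t] by (simp add: z_def)
    hence "spow (1 / (p - 1)) (z t) = a t powr (1 / (p - 1)) * w' t"
      using at p by (simp add: spow_mult spow_spow spow_of_pos)
    thus ?thesis
      using at by (simp add: mult.assoc [symmetric] flip: powr_add)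
  qed
  show thesis
  proof (rule that [OF w(2,3,4)])
    show "(w has_real_derivative b t * spow (1 / (p - 1)) (z t)) (at t within {c..d})" if "t \<in> {c..d}" for t
      by (rule DERIV_within_Icc_if_interior [OF w(1) bz _ that]) (use w(5) w' in auto)
    show "(z has_real_derivative - (l * (a t * spow (p - 1) (w t)))) (at t within {c..d})"
      if "t \<in> {c..d}" for t
      using z [OF that] by (simp add: g_def)
  qed
qed

text \<open>Otherwise \<open>w z\<close> is nondecreasing and vanishes at both ends.\<close>

lemma eigenvalue_pos:
  assumes l: "l \<in> dirichlet_eigenvalues p c d a"
  shows "l > 0"
proof (rule ccontr)
  assume "\<not> l > 0"
  obtain w z where wz: "w c = 0" "w d = 0" "\<exists>t\<in>{c<..<d}. w t \<noteq> 0"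
    "\<And>t. t \<in> {c..d} \<Longrightarrow> (w has_real_derivative b t * spow (1 / (p - 1)) (z t)) (at t within {c..d})"
    "\<And>t. t \<in> {c..d} \<Longrightarrow> (z has_real_derivative - (l * (a t * spow (p - 1) (w t)))) (at t within {c..d})"
    by (rule normal_form [OF l]) blast
  define D where "D t = b t * \<bar>z t\<bar> powr (p / (p - 1)) - l * (a t * \<bar>w t\<bar> powr p)" for t
  have wz': "((\<lambda>t. w t * z t) has_real_derivative D t) (at t within {c..d})" if "t \<in> {c..d}" for t
  proof -
    have "((\<lambda>t. w t * z t) has_real_derivative
        b t * spow (1 / (p - 1)) (z t) * z t + - (l * (a t * spow (p - 1) (w t))) * w t) (at t within {c..d})"
      by (intro DERIV_mult wz that)
    also have "b t * spow (1 / (p - 1)) (z t) * z t + - (l * (a t * spow (p - 1) (w t))) * w t = D t"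
      using spow_mult_self [of "p - 1" "w t"] by (simp add: D_def spow_mult_self_conj [symmetric] mult.assoc)
    finally show ?thesis .
  qed
  have wz'_int: "((\<lambda>t. w t * z t) has_real_derivative D t) (at t)" if "t \<in> {c<..<d}" for t
    using wz' [of t] that at_within_Icc_at [of c t d] by simp
  have cont_wz: "continuous_on {c..d} (\<lambda>t. w t * z t)"
    using wz' by (rule DERIV_continuous_on)
  have D: "b t * \<bar>z t\<bar> powr (p / (p - 1)) \<le> D t" if "t \<in> {c..d}" for t
    using \<open>\<not> l > 0\<close> pos [OF that] by (simp add: D_def mult_nonpos_nonneg)
  have "D t \<ge> 0" if "t \<in> {c..d}" for t
    using D [OF that] by (rule order_trans [rotated]) simp
  hence der: "\<exists>l. ((\<lambda>t. w t * z t) has_real_derivative l) (at t) \<and> l \<ge> 0" if "t \<in> {c<..<d}" for t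
    using wz'_int [OF that] that by (intro exI [of _ "D t"]) auto
  have mono: "w s * z s \<le> w t * z t" if "c \<le> s" "s \<le> t" "t \<le> d" for s t
    using that
    by (intro DERIV_nonneg_imp_increasing_open [of s t "\<lambda>t. w t * z t"] continuous_on_subset [OF cont_wz] der)
       auto
  have zero: "w t * z t = 0" if "t \<in> {c..d}" for t
    using mono [of c t] mono [of t d] that wz(1,2) by simp
  \<comment> \<open>Since \<open>w z\<close> vanishes identically, so does its derivative
    \<open>D\<close>; the summand with \<open>z\<close> is nonnegative and at most \<open>D\<close>,
    so \<open>z\<close> vanishes, and then \<open>w\<close> has zero derivative.\<close>
  have z0: "z t = 0" if t: "t \<in> {c<..<d}" for t
  proof -
    have "((\<lambda>t. 0) has_real_derivative D t) (at t)"
      by (rule has_field_derivative_transform_within_open [OF wz'_int [OF t] open_greaterThanLessThan t])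
         (simp add: zero)
    hence "D t = 0" using DERIV_unique DERIV_const by blast
    hence "b t * \<bar>z t\<bar> powr (p / (p - 1)) \<le> 0" using D [of t] t by simp
    thus ?thesis using pos [of t] t by (simp add: mult_le_0_iff)
  qed
  have "w t = w c" if "t \<in> {c..d}" for t
  proof (rule DERIV_isconst2 [OF cd])
    show "continuous_on {c..d} w" using wz(4) by (rule DERIV_continuous_on)
    show "(w has_real_derivative 0) (at x)" if "c < x" "x < d" for x
      using wz(4) [of x] z0 [of x] that at_within_Icc_at [of c x d] by simp
  qed (use that in auto)
  thus False using wz(1,3) by auto
qed

text \<open>Positivity of the eigenvalues allows \<open>l = (p - 1) * \<alpha> powr p\<close> to be
  solved for \<alpha>; what remains is a constant rescaling of the flux.\<close>

lemma dirichlet_eigenvalues_eq: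
  "dirichlet_eigenvalues p c d a = {(p - 1) * \<alpha> powr p | \<alpha>. \<alpha> > 0 \<and> eigenparameter \<alpha>}"
proof (intro equalityI subsetI)
  fix l assume l: "l \<in> dirichlet_eigenvalues p c d a"
  obtain w z where wz: "w c = 0" "w d = 0" "\<exists>t\<in>{c<..<d}. w t \<noteq> 0"
    "\<And>t. t \<in> {c..d} \<Longrightarrow> (w has_real_derivative b t * spow (1 / (p - 1)) (z t)) (at t within {c..d})"
    "\<And>t. t \<in> {c..d} \<Longrightarrow> (z has_real_derivative - (l * (a t * spow (p - 1) (w t)))) (at t within {c..d})"
    by (rule normal_form [OF l]) blast
  have "l > 0" using l by (rule eigenvalue_pos)
  define \<alpha> where "\<alpha> = (l / (p - 1)) powr (1 / p)"
  have \<alpha>: "\<alpha> > 0" using \<open>l > 0\<close> p by (simp add: \<alpha>_def)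
  have l_eq: "l = (p - 1) * \<alpha> powr p"
    using \<open>l > 0\<close> p by (simp add: \<alpha>_def powr_powr)
  \<comment> \<open>Chosen so that both equations take their required form: s^(1/(p-1)) = 1 /
    \<alpha> serves the first, s l = (p - 1) \<alpha> the second.\<close>
  define s where "s = \<alpha> powr - (p - 1)"
  have s: "s > 0" "s powr (1 / (p - 1)) = 1 / \<alpha>" "s * l = (p - 1) * \<alpha>"
  proof -
    show "s > 0" using \<alpha> by (simp add: s_def)
    show "s powr (1 / (p - 1)) = 1 / \<alpha>"
    proof -
      have "- (p - 1) * (1 / (p - 1)) = - 1" using p by (simp add: field_simps)
      thus ?thesis unfolding s_def powr_powr using \<alpha> by (simp add: powr_minus divide_inverse)
    qed
    have "s * l = (p - 1) * (\<alpha> powr - (p - 1) * \<alpha> powr p)"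
      by (simp add: s_def l_eq)
    also have "\<alpha> powr - (p - 1) * \<alpha> powr p = \<alpha>"
      using \<alpha> by (simp flip: powr_add)
    finally show "s * l = (p - 1) * \<alpha>" .
  qed
  have "solves \<alpha> w (\<lambda>t. s * z t)"
    unfolding solves_def
  proof (intro ballI conjI)
    fix t assume t: "t \<in> {c..d}"
    show "(w has_real_derivative \<alpha> * b t * spow (1 / (p - 1)) (s * z t)) (at t within {c..d})"
      using wz(4) [OF t] s(1) \<alpha> by (simp add: spow_mult spow_of_pos s(2))
    have "((\<lambda>t. s * z t) has_real_derivative s * - (l * (a t * spow (p - 1) (w t)))) (at t within {c..d})"
      by (intro DERIV_cmult wz t)
    also have "s * - (l * (a t * spow (p - 1) (w t))) = - ((s * l) * a t * spow (p - 1) (w t))"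
      by simp
    finally show "((\<lambda>t. s * z t) has_real_derivative - ((p - 1) * \<alpha> * a t * spow (p - 1) (w t))) (at t within {c..d})"
      unfolding s(3) .
  qed
  moreover have "\<exists>t\<in>{c..d}. w t \<noteq> 0" using wz(3) by force
  ultimately have "eigenparameter \<alpha>"
    using wz(1,2) unfolding eigenparameter_def by blast
  thus "l \<in> {(p - 1) * \<alpha> powr p | \<alpha>. \<alpha> > 0 \<and> eigenparameter \<alpha>}"
    using \<alpha> l_eq by blast
next
  fix l assume "l \<in> {(p - 1) * \<alpha> powr p | \<alpha>. \<alpha> > 0 \<and> eigenparameter \<alpha>}"
  then obtain \<alpha> y z where \<alpha>: "l = (p - 1) * \<alpha> powr p" "\<alpha> > 0"
    and yz: "solves \<alpha> y z" "y c = 0" "y d = 0" "\<exists>t\<in>{c..d}. y t \<noteq> 0"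
    unfolding eigenparameter_def by blast
  define w' where "w' t = \<alpha> * b t * spow (1 / (p - 1)) (z t)" for t
  have flux: "\<alpha> powr (p - 1) * z t = a t * spow (p - 1) (w' t)" if "t \<in> {c..d}" for t
  proof -
    have "- (1 / (p - 1)) * (p - 1) = - 1" using p by (simp add: field_simps)
    hence "b t powr (p - 1) = 1 / a t"
      unfolding powr_powr using pos [OF that] by (simp add: powr_minus divide_inverse)
    hence "spow (p - 1) (w' t) = \<alpha> powr (p - 1) * (1 / a t) * z t"
      using pos [OF that] \<alpha> p by (simp add: w'_def spow_mult spow_spow spow_of_pos)
    thus ?thesis using pos [OF that] by simp
  qed
  have y': "(y has_real_derivative w' t) (at t within {c..d})" if "t \<in> {c..d}" for t
    using yz(1) that by (simp add: solves_def w'_def)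
  show "l \<in> dirichlet_eigenvalues p c d a"
    unfolding dirichlet_eigenvalues_def mem_Collect_eq
  proof (intro exI conjI ballI)
    show "continuous_on {c..d} y" using y' by (rule DERIV_continuous_on)
    show "\<exists>t\<in>{c<..<d}. y t \<noteq> 0"
      using yz by (metis atLeastAtMost_iff greaterThanLessThan_iff order_less_le)
    fix t assume t: "t \<in> {c<..<d}"
    hence td: "t \<in> {c..d}" by simp
    have at: "at t within {c..d} = at t" using t at_within_Icc_at [of c t d] by simp
    show "(y has_real_derivative w' t) (at t)"
      using y' [OF td] at by simp
    have "((\<lambda>t. \<alpha> powr (p - 1) * z t) has_real_derivative
        \<alpha> powr (p - 1) * - ((p - 1) * \<alpha> * a t * spow (p - 1) (y t))) (at t)"
      using yz(1) td unfolding solves_def at [symmetric] by (intro DERIV_cmult) blast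
    also have "\<alpha> powr (p - 1) * - ((p - 1) * \<alpha> * a t * spow (p - 1) (y t)) =
        - ((p - 1) * (\<alpha> powr (p - 1) * \<alpha>) * (a t * spow (p - 1) (y t)))"
      by simp
    also have "(p - 1) * (\<alpha> powr (p - 1) * \<alpha>) = l"
      using \<alpha> by (simp add: powr_diff)
    finally have "((\<lambda>t. \<alpha> powr (p - 1) * z t) has_real_derivative - (l * (a t * spow (p - 1) (y t)))) (at t)" .
    thus "((\<lambda>s. a s * phi p (w' s)) has_real_derivative - (l * (a t * phi p (y t)))) (at t)"
      unfolding phi_real
      by (rule has_field_derivative_transform_within_open [OF _ open_greaterThanLessThan t])
         (simp add: flux)
  qed (use yz in auto)
qed

end

text \<open>Exactly \<open>j - 1\<close> elements lie below \<open>f j\<close>, namely the values at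
  \<open>1\<close> to \<open>j - 1\<close>; this fits the count from one, and different elements
  have different ranks.\<close>

lemma kth_smallest_image:
  assumes f: "strict_mono_on {1..} f" and S: "S = f ` {1..}" and k: "k \<ge> 1"
  shows "kth_smallest S k = f k"
proof -
  have below: "{y \<in> S. y < f j} = f ` {1..<j}" if "j \<ge> 1" for j
    using f that unfolding S by (auto simp: strict_mono_on_less)
  have inj: "inj_on f A" if "A \<subseteq> {1..}" for A
    using strict_mono_on_imp_inj_on [OF f] that by (rule inj_on_subset)
  have card: "finite {y \<in> S. y < f j}" "card {y \<in> S. y < f j} + 1 = j" if "j \<ge> 1" for j
    unfolding below [OF that] using that by (subst card_image [OF inj] | force)+
  show ?thesis
    unfolding kth_smallest_def
  proof (rule the_equality)
    show "f k \<in> S \<and> finite {y \<in> S. y < f k} \<and> card {y \<in> S. y < f k} + 1 = k"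
      using card [OF k] k by (auto simp: S)
    fix x assume x: "x \<in> S \<and> finite {y \<in> S. y < x} \<and> card {y \<in> S. y < x} + 1 = k"
    then obtain j where "j \<ge> 1" "x = f j" by (auto simp: S)
    thus "x = f k" using card(2) [of j] x by auto
  qed
qed

text \<open>By monotonicity of the final angle, the \<open>k\<close>-th parameter is the one whose
  final angle is \<open>k\<close> half periods; comparing this angle with
  \<open>\<alpha> * m * (d - c)\<close> and \<open>\<alpha> * M * (d - c)\<close> encloses the
  parameter. The larger coefficient bound yields the smaller eigenvalue bound.\<close>

lemma kth_dirichlet_eigenvalue_bounds:
  assumes "dirichlet p c d a" and k: "k \<ge> 1" and m: "m > 0"
    and lower: "\<And>t. t \<in> {c..d} \<Longrightarrow> m \<le> a t" "\<And>t. t \<in> {c..d} \<Longrightarrow> m \<le> a t powr - (1 / (p - 1))"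
    and upper: "\<And>t. t \<in> {c..d} \<Longrightarrow> a t \<le> M" "\<And>t. t \<in> {c..d} \<Longrightarrow> a t powr - (1 / (p - 1)) \<le> M"
  shows "kth_smallest (dirichlet_eigenvalues p c d a) k \<in>
    {(p - 1) * (real k * half_period p / (M * (d - c))) powr p ..
     (p - 1) * (real k * half_period p / (m * (d - c))) powr p}"
proof -
  interpret dirichlet p c d a by fact
  note P = half_period_pos [OF p]
  define A where "A n = (SOME \<alpha>. \<alpha> > 0 \<and> final_angle \<alpha> = real n * half_period p)" for n
  have A: "A n > 0" "final_angle (A n) = real n * half_period p" if n: "n \<ge> 1" for n
  proof -
    have "\<exists>\<alpha>. \<alpha> > 0 \<and> final_angle \<alpha> = real n * half_period p"
      using final_angle_attains [of "real n * half_period p"] P n by auto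
    hence "A n > 0 \<and> final_angle (A n) = real n * half_period p"
      unfolding A_def by (rule someI_ex)
    thus "A n > 0" "final_angle (A n) = real n * half_period p" by auto
  qed
  have inj: "\<alpha> = \<beta>" if "\<alpha> > 0" "\<beta> > 0" "final_angle \<alpha> = final_angle \<beta>" for \<alpha> \<beta>
    using final_angle_strict_mono [of \<alpha> \<beta>] final_angle_strict_mono [of \<beta> \<alpha>] that
    by (cases \<alpha> \<beta> rule: linorder_cases) auto
  let ?f = "\<lambda>n. (p - 1) * A n powr p"
  have "strict_mono_on {1..} ?f"
  proof (rule strict_mono_onI)
    fix i j :: nat assume ij: "i \<in> {1..}" "j \<in> {1..}" "i < j"
    have "final_angle (A i) < final_angle (A j)"
      using A ij P by simp
    hence "A i < A j"
      using final_angle_strict_mono [of "A j" "A i"] A [of j] ij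
      by (cases "A i" "A j" rule: linorder_cases) auto
    thus "?f i < ?f j"
      using A(1) [of i] ij p by (auto intro!: mult_strict_left_mono powr_less_mono2)
  qed
  moreover have "dirichlet_eigenvalues p c d a = ?f ` {1..}"
  proof (intro equalityI subsetI)
    fix l assume "l \<in> dirichlet_eigenvalues p c d a"
    then obtain \<alpha> where \<alpha>: "l = (p - 1) * \<alpha> powr p" "\<alpha> > 0" "eigenparameter \<alpha>"
      unfolding dirichlet_eigenvalues_eq by blast
    then obtain n where n: "n \<ge> 1" "final_angle \<alpha> = real n * half_period p"
      using eigenparameter_iff by blast
    hence "\<alpha> = A n" using inj [of \<alpha> "A n"] A [of n] \<alpha> by simp
    thus "l \<in> ?f ` {1..}" using \<alpha> n by auto
  next
    fix l assume "l \<in> ?f ` {1..}"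
    then obtain n where n: "n \<ge> 1" "l = (p - 1) * A n powr p" by auto
    thus "l \<in> dirichlet_eigenvalues p c d a"
      unfolding dirichlet_eigenvalues_eq using A [of n] eigenparameter_iff [of "A n"] by blast
  qed
  ultimately have eq: "kth_smallest (dirichlet_eigenvalues p c d a) k = (p - 1) * A k powr p"
    using k by (rule kth_smallest_image)
  have M: "M > 0"
    using m lower(1) [of c] upper(1) [of c] cd by simp
  have "A k * m * (d - c) \<le> real k * half_period p" "real k * half_period p \<le> A k * M * (d - c)"
    using final_angle_bounds [OF _ lower upper, of "A k"] A [OF k] by auto
  hence "real k * half_period p / (M * (d - c)) \<le> A k" "A k \<le> real k * half_period p / (m * (d - c))"
    using m M cd by (simp_all add: field_simps)
  thus ?thesis
    unfolding eq atLeastAtMost_iff using p P M cd A(1) [OF k]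
    by (intro conjI mult_left_mono powr_mono2) auto
qed

section \<open>Radial solutions in an annulus\<close>

lemma closure_annulus_subset: "closure (annulus R Rb :: (real ^ 'n) set) \<subseteq> {x. R \<le> norm x \<and> norm x \<le> Rb}"
proof (rule closure_minimal)
  have "closed {x :: real ^ 'n. R \<le> norm x}" "closed {x :: real ^ 'n. norm x \<le> Rb}"
    by (intro closed_Collect_le continuous_intros)+
  thus "closed {x :: real ^ 'n. R \<le> norm x \<and> norm x \<le> Rb}"
    unfolding Collect_conj_eq by (rule closed_Int)
qed (auto simp: annulus_def)

lemma open_annulus: "open (annulus R Rb :: (real ^ 'n) set)"
  unfolding annulus_def Collect_conj_eq
  by (intro open_Int open_Collect_less continuous_intros)

lemma frontier_annulus_subset:
  "frontier (annulus R Rb :: (real ^ 'n) set) \<subseteq> {x. norm x = R \<or> norm x = Rb}"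
  using closure_annulus_subset [of R Rb] interior_open [OF open_annulus, of R Rb]
  by (force simp: frontier_def annulus_def)

lemma axis_in_closure_annulus:
  assumes "0 < R" "R < Rb" "r \<in> {R..Rb}"
  shows "r *\<^sub>R axis i 1 \<in> closure (annulus R Rb :: (real ^ 'n) set)"
proof -
  have "(\<lambda>r. r *\<^sub>R axis i 1) ` closure {R<..<Rb} \<subseteq> closure (annulus R Rb :: (real ^ 'n) set)"
    using assms
    by (intro image_closure_subset continuous_intros)
       (auto simp: annulus_def intro!: subsetD [OF closure_subset])
  thus ?thesis using assms by auto
qed

lemma axis_in_frontier_annulus:
  assumes "0 < R" "R < Rb" "r = R \<or> r = Rb"
  shows "r *\<^sub>R axis i 1 \<in> frontier (annulus R Rb :: (real ^ 'n) set)"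
proof -
  have "r *\<^sub>R axis i 1 \<notin> (annulus R Rb :: (real ^ 'n) set)"
    using assms by (auto simp: annulus_def)
  thus ?thesis
    using assms axis_in_closure_annulus [of R Rb r i]
    by (auto simp: frontier_def interior_open [OF open_annulus])
qed

lemma phi_scaleR_unit:
  fixes y :: "'v::real_normed_vector"
  shows "phi p ((s / norm y) *\<^sub>R y) = (phi p s / norm y) *\<^sub>R y"
  by (cases "y = 0") (auto simp: phi_def)

text \<open>The Jacobian is f / r times the identity plus a multiple of the rank-one matrix of
  \<open>x\<close> with itself; their traces are N f / r and f' - f / r.\<close>

lemma has_divergence_radial:
  fixes x :: "real ^ 'n"
  assumes x: "x \<noteq> 0" and f: "(f has_real_derivative f') (at (norm x))"
  shows "has_divergence (\<lambda>y. (f (norm y) / norm y) *\<^sub>R y)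
    (f' + (real CARD('n) - 1) * f (norm x) / norm x) x"
proof -
  let ?r = "norm x"
  let ?k' = "(f' * ?r - f ?r) / (?r * ?r)"
  have k: "((\<lambda>r. f r / r) has_real_derivative ?k') (at ?r)"
    using x DERIV_divide [OF f DERIV_ident] by simp
  have "((\<lambda>y. f (norm y) / norm y) has_derivative (\<lambda>h. ?k' * inner h (sgn x))) (at x)"
    using diff_chain_at [OF has_derivative_norm [OF x] k [unfolded has_field_derivative_def]]
    by (simp add: o_def)
  from has_derivative_scaleR [OF this has_derivative_ident]
  have D: "((\<lambda>y. (f (norm y) / norm y) *\<^sub>R y) has_derivative
      (\<lambda>h. (f ?r / ?r) *\<^sub>R h + (?k' * inner h (sgn x)) *\<^sub>R x)) (at x)" .
  have norm_sq: "(\<Sum>i\<in>UNIV. x $ i * x $ i) = ?r\<^sup>2"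
    by (simp add: power2_norm_eq_inner inner_vec_def)
  have "(\<Sum>i\<in>UNIV. ((f ?r / ?r) *\<^sub>R axis i 1 + (?k' * inner (axis i 1) (sgn x)) *\<^sub>R x) $ i) =
      (\<Sum>i\<in>(UNIV :: 'n set). f ?r / ?r + ?k' / ?r * (x $ i * x $ i))"
    by (intro sum.cong refl) (simp add: inner_axis' sgn_div_norm field_simps)
  also have "\<dots> = real CARD('n) * (f ?r / ?r) + ?k' / ?r * (?r)\<^sup>2"
    by (simp only: sum.distrib sum_distrib_left [symmetric] norm_sq sum_constant)
  also have "\<dots> = f' + (real CARD('n) - 1) * f ?r / ?r"
    using x by (simp add: field_simps power2_eq_square)
  finally show ?thesis
    unfolding has_divergence_def using D by (intro exI conjI) auto
qed

text \<open>On a coordinate axis the partial derivatives are the radial one and \<open>f r / r\<close> for every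
  other coordinate.\<close>

lemma has_divergence_radial_axisD:
  fixes F :: "real ^ 'n \<Rightarrow> real ^ 'n"
  assumes div: "has_divergence F d (r *\<^sub>R axis i 1)" and r: "R < r" "r < Rb" "0 < R"
    and F: "\<And>y. y \<in> annulus R Rb \<Longrightarrow> F y = (f (norm y) / norm y) *\<^sub>R y"
  shows "(f has_real_derivative d - (real CARD('n) - 1) * f r / r) (at r)"
proof -
  let ?e = "axis i 1 :: real ^ 'n"
  obtain D where D: "(F has_derivative D) (at (r *\<^sub>R ?e))" "d = (\<Sum>i\<in>UNIV. D (axis i 1) $ i)"
    using div unfolding has_divergence_def by blast
  have lin: "D (s *\<^sub>R v) = s *\<^sub>R D v" for s v
    using has_derivative_bounded_linear [OF D(1)] by (simp add: linear_simps)
  have "((\<lambda>s. s *\<^sub>R ?e) has_derivative (\<lambda>h. h *\<^sub>R ?e)) (at r)"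
    by (auto intro!: derivative_eq_intros)
  from diff_chain_at [OF this D(1)]
  have "((\<lambda>s. F (s *\<^sub>R ?e)) has_derivative (\<lambda>h. h *\<^sub>R D ?e)) (at r)"
    by (simp add: o_def lin)
  from bounded_linear.has_derivative [OF bounded_linear_vec_nth [of i] this]
  have "((\<lambda>s. F (s *\<^sub>R ?e) $ i) has_real_derivative D ?e $ i) (at r)"
    by (simp add: has_field_derivative_def mult_commute_abs)
  hence f: "(f has_real_derivative D ?e $ i) (at r)"
  proof (rule has_field_derivative_transform_within_open [OF _ open_greaterThanLessThan])
    show "r \<in> {R<..<Rb}" using r by simp
    fix s assume "s \<in> {R<..<Rb}"
    thus "F (s *\<^sub>R ?e) $ i = f s"
      using r by (subst F) (auto simp: annulus_def)
  qed
  have other: "D (axis j 1) $ j = f r / r" if j: "j \<noteq> i" for j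
  proof -
    let ?c = "\<lambda>s. r *\<^sub>R ?e + s *\<^sub>R axis j 1"
    have "(?c has_derivative (\<lambda>h. h *\<^sub>R axis j 1)) (at 0)"
      by (auto intro!: derivative_eq_intros)
    from diff_chain_at [OF this, of F D] D(1)
    have "((\<lambda>s. F (?c s)) has_derivative (\<lambda>h. h *\<^sub>R D (axis j 1))) (at 0)"
      by (simp add: o_def lin)
    from bounded_linear.has_derivative [OF bounded_linear_vec_nth [of j] this]
    have 1: "((\<lambda>s. F (?c s) $ j) has_real_derivative D (axis j 1) $ j) (at 0)"
      by (simp add: has_field_derivative_def mult_commute_abs)
    have cont: "continuous_on UNIV ?c" by (intro continuous_intros)
    have "isCont (\<lambda>s. norm (?c s)) 0" by (intro continuous_intros)
    moreover have "isCont (\<lambda>\<rho>. f \<rho> / \<rho>) (norm (?c 0))"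
      using r DERIV_isCont [OF f] by (intro continuous_intros) auto
    ultimately have "isCont (\<lambda>s. f (norm (?c s)) / norm (?c s)) 0"
      by (rule isCont_o2)
    \<comment> \<open>The derivative at \<open>0\<close> of a continuous function times
      \<open>s\<close> is the value of that function at \<open>0\<close>, so continuity of
      \<open>f\<close> at \<open>r\<close> is all that enters.\<close>
    hence "((\<lambda>s. f (norm (?c s)) / norm (?c s) * s) has_real_derivative f r / r) (at 0)"
      unfolding CARAT_DERIV using r
      by (intro exI [of _ "\<lambda>s. f (norm (?c s)) / norm (?c s)"]) simp
    hence 2: "((\<lambda>s. F (?c s) $ j) has_real_derivative f r / r) (at 0)"
    proof (rule has_field_derivative_transform_within_open)
      show "open (?c -` annulus R Rb)" by (rule open_vimage [OF open_annulus cont])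
      show "0 \<in> ?c -` annulus R Rb" using r by (simp add: annulus_def)
      fix s assume "s \<in> ?c -` annulus R Rb"
      thus "f (norm (?c s)) / norm (?c s) * s = F (?c s) $ j"
        using j by (subst F) (auto simp: axis_def)
    qed
    show ?thesis using 1 2 by (rule DERIV_unique)
  qed
  have "d = D ?e $ i + (\<Sum>j\<in>UNIV - {i}. D (axis j 1) $ j)"
    unfolding D(2) by (rule sum.remove) auto
  also have "(\<Sum>j\<in>UNIV - {i}. D (axis j 1) $ j) = (\<Sum>j\<in>UNIV - {i}. f r / r)"
    by (intro sum.cong refl other) auto
  also have "\<dots> = (real CARD('n) - 1) * f r / r"
    by (simp add: card_Diff_singleton of_nat_diff Suc_le_eq)
  finally show ?thesis using f by simp
qed

text \<open>Since a' = (N - 1) a / r, multiplying the radial divergence f' + (N - 1) f / r by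
  \<open>a\<close> gives (a f)'. One inclusion multiplies by \<open>a\<close>, the other divides by
  it.\<close>

lemma radial_eigenvalues_eq:
  assumes p: "p > 1" and R: "0 < R" "R < Rb"
  shows "radial_eigenvalues TYPE('n::finite) p R Rb =
    dirichlet_eigenvalues p R Rb (\<lambda>r. (r / R) ^ (CARD('n) - 1))"
proof -
  let ?N = "CARD('n)"
  let ?a = "\<lambda>r. (r / R) ^ (?N - 1)"
  let ?A = "annulus R Rb :: (real ^ 'n) set"
  have N: "real (?N - 1) = real ?N - 1"
    by (simp add: of_nat_diff Suc_le_eq)
  have a': "(?a has_real_derivative (real ?N - 1) * ?a r / r) (at r)" if "r > 0" for r
  proof -
    have "(?a has_real_derivative real (?N - 1) * (r / R) ^ (?N - 1 - 1) * (1 / R)) (at r)"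
      by (rule derivative_eq_intros refl | use R in simp)+
    also have "real (?N - 1) * (r / R) ^ (?N - 1 - 1) * (1 / R) = (real ?N - 1) * ?a r / r"
      unfolding N [symmetric] using that R by (cases "?N - 1") (auto simp: field_simps)
    finally show ?thesis .
  qed
  show ?thesis
  proof (intro equalityI subsetI)
    fix l assume "l \<in> radial_eigenvalues TYPE('n) p R Rb"
    then obtain u :: "real ^ 'n \<Rightarrow> real" where "radial_eigenfunction p R Rb l u"
      by (auto simp: radial_eigenvalues_def)
    then obtain w g where w: "\<And>x. x \<in> closure ?A \<Longrightarrow> u x = w (norm x)"
      and u: "continuous_on (closure ?A) u" "\<And>x. x \<in> frontier ?A \<Longrightarrow> u x = 0"
        "\<exists>x\<in>?A. u x \<noteq> 0"
      and g: "\<And>x. x \<in> ?A \<Longrightarrow> GDERIV u x :> g x"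
        "\<And>x. x \<in> ?A \<Longrightarrow> \<exists>d. has_divergence (\<lambda>y. phi p (g y)) d x \<and> - d = l * phi p (u x)"
      unfolding radial_eigenfunction_def by blast
    \<comment> \<open>Fixes a coordinate direction along which the profile is read off.\<close>
    obtain i :: 'n where True by blast
    let ?e = "axis i 1 :: real ^ 'n"
    have A_axis: "r *\<^sub>R ?e \<in> ?A" if "r \<in> {R<..<Rb}" for r
      using that R by (simp add: annulus_def)
    have w_axis: "w r = u (r *\<^sub>R ?e)" if "r \<in> {R..Rb}" for r
      using w [OF axis_in_closure_annulus [OF R that]] that R by simp
    define w' where "w' r = inner ?e (g (r *\<^sub>R ?e))" for r
    have w': "(w has_real_derivative w' r) (at r)" if r: "r \<in> {R<..<Rb}" for r
    proof -
      have "((\<lambda>s. s *\<^sub>R ?e) has_derivative (\<lambda>h. h *\<^sub>R ?e)) (at r)"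
        by (auto intro!: derivative_eq_intros)
      from diff_chain_at [OF this g(1) [OF A_axis [OF r], unfolded gderiv_def]]
      have "((\<lambda>s. u (s *\<^sub>R ?e)) has_real_derivative w' r) (at r)"
        by (simp add: o_def has_field_derivative_def w'_def mult_commute_abs)
      thus ?thesis
        by (rule has_field_derivative_transform_within_open [OF _ open_greaterThanLessThan r])
           (simp add: w_axis)
    qed
    \<comment> \<open>The field \<open>g\<close> is only known to be a gradient of \<open>u\<close>;
      uniqueness of the derivative makes it radial with profile \<open>w'\<close>.\<close>
    have g_eq: "g x = (w' (norm x) / norm x) *\<^sub>R x" if x: "x \<in> ?A" for x
    proof -
      have x0: "norm x \<in> {R<..<Rb}" "x \<noteq> 0" using x R by (auto simp: annulus_def)
      have "GDERIV (\<lambda>y. w (norm y)) x :> w' (norm x) *\<^sub>R sgn x"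
        by (rule GDERIV_DERIV_compose [OF GDERIV_norm [OF x0(2)] w' [OF x0(1)]])
      hence "(u has_derivative (\<lambda>h. inner h (w' (norm x) *\<^sub>R sgn x))) (at x)"
        unfolding gderiv_def
        by (rule has_derivative_transform_within_open [OF _ open_annulus x])
           (simp add: w subsetD [OF closure_subset])
      from has_derivative_unique [OF this g(1) [OF x, unfolded gderiv_def]]
      have "inner h (w' (norm x) *\<^sub>R sgn x) = inner h (g x)" for h
        by (rule fun_cong)
      hence "inner h (w' (norm x) *\<^sub>R sgn x - g x) = 0" for h
        by (simp add: inner_diff_right)
      from this [of "w' (norm x) *\<^sub>R sgn x - g x"] show ?thesis
        by (simp add: sgn_div_norm divide_inverse)
    qed
    show "l \<in> dirichlet_eigenvalues p R Rb ?a"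
      unfolding dirichlet_eigenvalues_def mem_Collect_eq
    proof (rule exI [of _ w], rule exI [of _ w'], intro conjI ballI)
      have "continuous_on {R..Rb} (\<lambda>r. u (r *\<^sub>R ?e))"
        by (rule continuous_on_compose2 [OF u(1)])
           (use R in \<open>auto intro!: continuous_intros axis_in_closure_annulus\<close>)
      thus "continuous_on {R..Rb} w"
        by (rule continuous_on_eq) (simp add: w_axis)
      show "w R = 0" "w Rb = 0"
        using R by (auto simp: w_axis intro!: u(2) axis_in_frontier_annulus)
      obtain x where x: "x \<in> ?A" "u x \<noteq> 0" using u(3) by blast
      hence "w (norm x) \<noteq> 0" using w [of x] closure_subset [of ?A] by auto
      thus "\<exists>t\<in>{R<..<Rb}. w t \<noteq> 0"
        using x by (auto simp: annulus_def)
      fix r assume r: "r \<in> {R<..<Rb}"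
      show "(w has_real_derivative w' r) (at r)" using r by (rule w')
      obtain d where d: "has_divergence (\<lambda>y. phi p (g y)) d (r *\<^sub>R ?e)" "- d = l * phi p (w r)"
        using g(2) [OF A_axis [OF r]] w_axis [of r] r by auto
      have r': "R < r" "r < Rb" "0 < r" using r R by auto
      have "((\<lambda>r. phi p (w' r)) has_real_derivative d - (real ?N - 1) * phi p (w' r) / r) (at r)"
        by (rule has_divergence_radial_axisD [OF d(1) r'(1,2) R(1)])
           (simp add: g_eq phi_scaleR_unit)
      from DERIV_mult [OF a' [OF r'(3)] this]
      have "((\<lambda>s. ?a s * phi p (w' s)) has_real_derivative
          (real ?N - 1) * ?a r / r * phi p (w' r) +
          (d - (real ?N - 1) * phi p (w' r) / r) * ?a r) (at r)" .
      also have "(real ?N - 1) * ?a r / r * phi p (w' r) +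
          (d - (real ?N - 1) * phi p (w' r) / r) * ?a r = - (- d * ?a r)"
        by (simp add: algebra_simps)
      also have "- (- d * ?a r) = - (l * (?a r * phi p (w r)))"
        unfolding d(2) by (simp add: mult_ac)
      finally show "((\<lambda>s. ?a s * phi p (w' s)) has_real_derivative - (l * (?a r * phi p (w r)))) (at r)" .
    qed
  next
    fix l assume "l \<in> dirichlet_eigenvalues p R Rb ?a"
    then obtain w w' where w: "continuous_on {R..Rb} w" "w R = 0" "w Rb = 0" "\<exists>t\<in>{R<..<Rb}. w t \<noteq> 0"
      and w': "\<And>t. t \<in> {R<..<Rb} \<Longrightarrow> (w has_real_derivative w' t) (at t)"
      and flux: "\<And>t. t \<in> {R<..<Rb} \<Longrightarrow>
        ((\<lambda>s. ?a s * phi p (w' s)) has_real_derivative - (l * (?a t * phi p (w t)))) (at t)"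
      unfolding dirichlet_eigenvalues_def by blast
    have f': "((\<lambda>s. phi p (w' s)) has_real_derivative
        - (l * phi p (w r)) - (real ?N - 1) * phi p (w' r) / r) (at r)" if r: "r \<in> {R<..<Rb}" for r
    proof -
      have r0: "r > 0" "?a r \<noteq> 0" using r R by auto
      from DERIV_divide [OF flux [OF r] a' [OF r0(1)] r0(2)]
      have "((\<lambda>s. ?a s * phi p (w' s) / ?a s) has_real_derivative
          (- (l * (?a r * phi p (w r))) * ?a r - ?a r * phi p (w' r) * ((real ?N - 1) * ?a r / r)) /
          (?a r * ?a r)) (at r)" .
      also have "(- (l * (?a r * phi p (w r))) * ?a r - ?a r * phi p (w' r) * ((real ?N - 1) * ?a r / r)) /
          (?a r * ?a r) = - (l * phi p (w r)) - (real ?N - 1) * phi p (w' r) / r"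
      proof -
        have "(- (l * (x * y)) * x - x * z * (n * x / r)) / (x * x) = - (l * y) - n * z / r"
          if "x \<noteq> 0" for x y z n :: real
          using that r0(1) by (simp add: divide_simps) (simp add: algebra_simps)
        thus ?thesis using r0(2) by blast
      qed
      finally show ?thesis
        by (rule has_field_derivative_transform_within_open [OF _ open_greaterThanLessThan r])
           (use R in auto)
    qed
    define u where "u x = w (norm x)" for x :: "real ^ 'n"
    have "radial_eigenfunction p R Rb l u"
      unfolding radial_eigenfunction_def
    proof (intro conjI exI [of _ w] ballI exI [of _ "\<lambda>x. (w' (norm x) / norm x) *\<^sub>R x"])
      show "u x = w (norm x)" for x by (simp add: u_def)
      show "continuous_on (closure ?A) u"
        unfolding u_def
        by (rule continuous_on_compose2 [OF w(1)])
           (use closure_annulus_subset [of R Rb] in \<open>auto intro!: continuous_intros\<close>)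
      show "u x = 0" if "x \<in> frontier ?A" for x
        using that frontier_annulus_subset [of R Rb] w(2,3) by (auto simp: u_def)
      obtain t where t: "t \<in> {R<..<Rb}" "w t \<noteq> 0" using w(4) by blast
      obtain i :: 'n where True by blast
      show "\<exists>x\<in>?A. u x \<noteq> 0"
        by (rule bexI [of _ "t *\<^sub>R axis i 1"]) (use t R in \<open>auto simp: u_def annulus_def\<close>)
      fix x assume x: "x \<in> ?A"
      have x0: "norm x \<in> {R<..<Rb}" "x \<noteq> 0" using x R by (auto simp: annulus_def)
      have "GDERIV u x :> w' (norm x) *\<^sub>R sgn x"
        unfolding u_def by (rule GDERIV_DERIV_compose [OF GDERIV_norm [OF x0(2)] w' [OF x0(1)]])
      thus "GDERIV u x :> (w' (norm x) / norm x) *\<^sub>R x"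
        by (simp add: sgn_div_norm divide_inverse)
      show "\<exists>d. has_divergence (\<lambda>y. phi p ((w' (norm y) / norm y) *\<^sub>R y)) d x \<and> - d = l * phi p (u x)"
        unfolding phi_scaleR_unit u_def
        using has_divergence_radial [OF x0(2) f' [OF x0(1)]] by auto
    qed
    thus "l \<in> radial_eigenvalues TYPE('n) p R Rb"
      by (auto simp: radial_eigenvalues_def)
  qed
qed

section \<open>The limit problems on the unit interval\<close>

lemma p_interval_eigenvalues_eq: "p_interval_eigenvalues p = dirichlet_eigenvalues p 0 1 (\<lambda>_. 1)"
proof -
  have "(\<exists>d. (f has_real_derivative d) F \<and> d + x = 0) \<longleftrightarrow> (f has_real_derivative - x) F"
    for f x F by (metis add.left_inverse eq_neg_iff_add_eq_0)
  thus ?thesis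
    by (simp add: p_interval_eigenvalues_def dirichlet_eigenvalues_def)
qed

lemma interval_eigenvalues_eq: "interval_eigenvalues = p_interval_eigenvalues 2"
proof -
  have "phi 2 x = x" for x :: real by (simp add: phi_real)
  thus ?thesis
    by (simp add: interval_eigenvalues_def p_interval_eigenvalues_def)
qed

section \<open>Limits\<close>

lemma pi_p_eq: "pi_p p = (p - 1) powr (1 / p) * half_period p"
  by (simp add: pi_p_def half_period_def)

lemma p_eigenvalue_eq:
  assumes "p > 1"
  shows "(p - 1) * (real k * half_period p) powr p = (real k * pi_p p) powr p"
proof -
  have "((p - 1) powr (1 / p)) powr p = p - 1"
    using assms by (simp add: powr_powr)
  thus ?thesis
    using half_period_pos [OF assms] assms by (simp add: pi_p_eq powr_mult)
qed

lemma pi_p_2: "pi_p 2 = pi"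
  by (simp add: pi_p_def)

text \<open>For the constant weight \<open>1\<close> both coefficient bounds are \<open>1\<close>,
  and the enclosure of the eigenvalue shrinks to a point.\<close>

lemma kth_p_interval_eigenvalue:
  assumes p: "p > 1" and k: "k \<ge> 1"
  shows "kth_smallest (p_interval_eigenvalues p) k = (real k * pi_p p) powr p"
proof -
  have "dirichlet p 0 1 (\<lambda>_. 1)"
    using p by unfold_locales auto
  from kth_dirichlet_eigenvalue_bounds [OF this k, of 1 1] show ?thesis
    using p by (simp add: p_interval_eigenvalues_eq p_eigenvalue_eq)
qed

text \<open>On an interval of length one far out the weight varies only by the factor ((R + 1) /
  R)^(N-1), which tends to one, so the enclosure closes on the constant-coefficient
  eigenvalue.\<close>

lemma radial_eigenvalue_tendsto:
  assumes p: "p > 1" and k: "k \<ge> 1"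
  shows "((\<lambda>R. radial_eigenvalue TYPE('n::finite) p R (R + 1) k)
    \<longlongrightarrow> (real k * pi_p p) powr p) at_top"
proof -
  let ?n = "CARD('n) - 1" and ?q = "1 / (p - 1)"
  \<comment> \<open>The value of the weight at the outer end; at the inner end the weight is
    \<open>1\<close>.\<close>
  define M where "M R = ((R + 1) / R) ^ ?n" for R :: real
  \<comment> \<open>The weight is at least \<open>1\<close>, and its negative power is smallest
    where the weight is largest; the minimum serves both.\<close>
  define m where "m R = min 1 (M R powr - ?q)" for R :: real
  have M_lim: "(M \<longlongrightarrow> 1) at_top"
    unfolding M_def by real_asymp
  have m_lim: "(m \<longlongrightarrow> 1) at_top"
    unfolding m_def using M_lim by (auto intro!: tendsto_eq_intros)
  have lim: "((\<lambda>R. (p - 1) * (real k * half_period p / (f R * (R + 1 - R))) powr p)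
      \<longlongrightarrow> (real k * pi_p p) powr p) at_top" if "(f \<longlongrightarrow> 1) at_top" for f :: "real \<Rightarrow> real"
    unfolding p_eigenvalue_eq [OF p, symmetric]
    using that half_period_pos [OF p] k by (auto intro!: tendsto_eq_intros)
  have "\<forall>\<^sub>F R in at_top. radial_eigenvalue TYPE('n) p R (R + 1) k \<in>
      {(p - 1) * (real k * half_period p / (M R * (R + 1 - R))) powr p ..
       (p - 1) * (real k * half_period p / (m R * (R + 1 - R))) powr p}"
    using eventually_gt_at_top [of 0]
  proof eventually_elim
    case (elim R)
    let ?a = "\<lambda>r. (r / R) ^ ?n"
    have a: "1 \<le> ?a r" "?a r \<le> M R" if "r \<in> {R..R + 1}" for r
      using that elim unfolding M_def by (auto intro!: one_le_power power_mono divide_right_mono)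
    have "M R \<ge> 1" using a [of R] elim by simp
    have "dirichlet p R (R + 1) ?a"
    proof
      show "0 < ?a t" if "t \<in> {R..R + 1}" for t
        using a(1) [OF that] by linarith
    qed (use p elim in \<open>auto intro!: continuous_intros\<close>)
    thus ?case
      unfolding radial_eigenvalue_def radial_eigenvalues_eq [OF p elim less_add_one]
    proof (rule kth_dirichlet_eigenvalue_bounds [OF _ k])
      show "m R > 0" using \<open>M R \<ge> 1\<close> by (simp add: m_def)
      fix t assume t: "t \<in> {R..R + 1}"
      show "?a t \<le> M R" by (rule a [OF t])
      show "m R \<le> ?a t" using a(1) [OF t] by (simp add: m_def)
      show "m R \<le> ?a t powr - ?q"
        using a [OF t] p powr_mono2' [of "- ?q" "?a t" "M R"] by (simp add: m_def min_le_iff_disj)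
      have "?a t powr - ?q \<le> 1 powr - ?q"
        using a(1) [OF t] p by (intro powr_mono2') auto
      thus "?a t powr - ?q \<le> M R" using \<open>M R \<ge> 1\<close> by simp
    qed
  qed
  hence "\<forall>\<^sub>F R in at_top. (p - 1) * (real k * half_period p / (M R * (R + 1 - R))) powr p \<le>
      radial_eigenvalue TYPE('n) p R (R + 1) k"
    "\<forall>\<^sub>F R in at_top. radial_eigenvalue TYPE('n) p R (R + 1) k \<le>
      (p - 1) * (real k * half_period p / (m R * (R + 1 - R))) powr p"
    by (auto elim!: eventually_mono)
  thus ?thesis
    using lim [OF M_lim] lim [OF m_lim] by (rule tendsto_sandwich)
qed

text \<open>A monotone \<open>h\<close> fixing \<open>1\<close> covers \<open>max 1\<close> and
  \<open>min 1\<close> alike: bounds on the weight pass through \<open>h\<close> and then unchanged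
  through an integral over an interval of length one.\<close>

lemma integral_mono_comp_tendsto_1:
  fixes w :: "real \<Rightarrow> real \<Rightarrow> real" and h :: "real \<Rightarrow> real"
  assumes h: "mono h" "continuous_on UNIV h" "h 1 = 1"
    and cont: "\<forall>\<^sub>F R in F. continuous_on {0..1} (w R)"
    and bounds: "\<forall>\<^sub>F R in F. \<forall>t\<in>{0..1}. l R \<le> w R t \<and> w R t \<le> u R"
    and lu: "(l \<longlongrightarrow> 1) F" "(u \<longlongrightarrow> 1) F"
  shows "((\<lambda>R. integral {0..1} (\<lambda>t. h (w R t))) \<longlongrightarrow> 1) F"
proof (rule tendsto_sandwich)
  have hc: "isCont h 1" using h(2) by (simp add: continuous_on_eq_continuous_at)
  show "((\<lambda>R. h (l R)) \<longlongrightarrow> 1) F" "((\<lambda>R. h (u R)) \<longlongrightarrow> 1) F"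
    using isCont_tendsto_compose [OF hc lu(1)] isCont_tendsto_compose [OF hc lu(2)] h(3) by simp_all
  have int: "(\<lambda>t. h (w R t)) integrable_on {0..1}" if "continuous_on {0..1} (w R)" for R
    by (intro integrable_continuous_interval continuous_on_compose2 [OF h(2) that]) auto
  show "\<forall>\<^sub>F R in F. h (l R) \<le> integral {0..1} (\<lambda>t. h (w R t))"
    using cont bounds
  proof eventually_elim
    case (elim R)
    have "integral {0..1} (\<lambda>t::real. h (l R)) \<le> integral {0..1} (\<lambda>t. h (w R t))"
      using elim by (intro integral_le int) (auto intro: monoD [OF h(1)])
    thus ?case by simp
  qed
  show "\<forall>\<^sub>F R in F. integral {0..1} (\<lambda>t. h (w R t)) \<le> h (u R)"
    using cont bounds
  proof eventually_elim
    case (elim R)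
    have "integral {0..1} (\<lambda>t. h (w R t)) \<le> integral {0..1} (\<lambda>t::real. h (u R))"
      using elim by (intro integral_le int) (auto intro: monoD [OF h(1)])
    thus ?case by simp
  qed
qed

lemma qbar_tendsto_1:
  assumes "\<forall>\<^sub>F R in at_top. continuous_on {0..1} (weight N p R (R + 1))"
    and "\<forall>\<^sub>F R in at_top. \<forall>t\<in>{0..1}. l R \<le> weight N p R (R + 1) t \<and> weight N p R (R + 1) t \<le> u R"
    and "(l \<longlongrightarrow> 1) at_top" "(u \<longlongrightarrow> 1) at_top"
  shows "((\<lambda>R. qbar_plus N p R (R + 1)) \<longlongrightarrow> 1) at_top"
    and "((\<lambda>R. qbar_minus N p R (R + 1)) \<longlongrightarrow> 1) at_top"
  unfolding qbar_plus_def qbar_minus_def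
  by (rule integral_mono_comp_tendsto_1 [OF _ _ _ assms, of "max 1"];
      auto intro!: monoI max.mono continuous_intros)
     (rule integral_mono_comp_tendsto_1 [OF _ _ _ assms, of "min 1"];
      auto intro!: monoI min.mono continuous_intros)

lemma qbar_tendsto_1_conformal:
  assumes p: "p > 1" and N: "real N = p"
  shows "((\<lambda>R. qbar_plus N p R (R + 1)) \<longlongrightarrow> 1) at_top"
    and "((\<lambda>R. qbar_minus N p R (R + 1)) \<longlongrightarrow> 1) at_top"
proof -
  \<comment> \<open>The values of the weight at \<open>t = 0\<close> and \<open>t = 1\<close>,
    between which it increases; both tend to one because \<open>ln (1 + 1 / R)\<close> is asymptotic
    to \<open>1 / R\<close>.\<close>
  let ?l = "\<lambda>R. (R * ln ((R + 1) / R)) powr p" and ?u = "\<lambda>R. ((R + 1) * ln ((R + 1) / R)) powr p"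
  have weight: "weight N p R Rb = (\<lambda>t. (R * (Rb / R) powr t * ln (Rb / R)) powr p)" for R Rb
    using N by (simp add: weight_def fun_eq_iff)
  have cont: "\<forall>\<^sub>F R in at_top. continuous_on {0..1} (weight N p R (R + 1))"
    using eventually_gt_at_top [of 0]
  proof eventually_elim
    case (elim R)
    thus ?case unfolding weight by (intro continuous_intros) auto
  qed
  have bounds: "\<forall>\<^sub>F R in at_top. \<forall>t\<in>{0..1}. ?l R \<le> weight N p R (R + 1) t \<and> weight N p R (R + 1) t \<le> ?u R"
    using eventually_gt_at_top [of 0]
  proof eventually_elim
    case (elim R)
    have ln: "ln ((R + 1) / R) \<ge> 0" using elim by simp
    have "1 \<le> ((R + 1) / R) powr t \<and> ((R + 1) / R) powr t \<le> (R + 1) / R" if "t \<in> {0..1}" for t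
      using elim that powr_mono [of 0 t "(R + 1) / R"] powr_mono [of t 1 "(R + 1) / R"] by simp
    hence "R \<le> R * ((R + 1) / R) powr t \<and> R * ((R + 1) / R) powr t \<le> R + 1" if "t \<in> {0..1}" for t
      using elim that mult_left_mono [of 1 "((R + 1) / R) powr t" R]
        mult_left_mono [of "((R + 1) / R) powr t" "(R + 1) / R" R] by simp
    thus ?case
      unfolding weight using elim ln p by (auto intro!: powr_mono2 mult_right_mono)
  qed
  have "((\<lambda>R::real. R * ln ((R + 1) / R)) \<longlongrightarrow> 1) at_top"
    by real_asymp
  moreover have "((\<lambda>R::real. (R + 1) * ln ((R + 1) / R)) \<longlongrightarrow> 1) at_top"
    by real_asymp
  ultimately have "(?l \<longlongrightarrow> 1 powr p) at_top" "(?u \<longlongrightarrow> 1 powr p) at_top"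
    by (intro tendsto_powr tendsto_const; simp)+
  hence lu: "(?l \<longlongrightarrow> 1) at_top" "(?u \<longlongrightarrow> 1) at_top" by simp_all
  show "((\<lambda>R. qbar_plus N p R (R + 1)) \<longlongrightarrow> 1) at_top"
    "((\<lambda>R. qbar_minus N p R (R + 1)) \<longlongrightarrow> 1) at_top"
    by (rule qbar_tendsto_1 [OF cont bounds lu])+
qed

text \<open>In the variable s = B - t the weight is a negative power, hence largest at t = 1. The
  end values are explicit because \<open>B\<close> and \<open>B - 1\<close> are (R + 1)^n and R^n
  over the same difference, and (R + 1)^n - R^n is asymptotic to n R^(n-1).\<close>

lemma qbar_tendsto_1_laplacian:
  assumes N: "N \<ge> 3"
  shows "((\<lambda>R. qbar_plus N 2 R (R + 1)) \<longlongrightarrow> 1) at_top"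
    and "((\<lambda>R. qbar_minus N 2 R (R + 1)) \<longlongrightarrow> 1) at_top"
proof -
  define n where "n = real N - 2"
  have n: "n > 0" using N by (simp add: n_def)
  let ?A = "\<lambda>R Rb. A_const N 2 R Rb" and ?B = "\<lambda>R Rb. B_const N 2 R Rb"
  define W where "W R Rb s = (1 / n)\<^sup>2 * (?A R Rb powr (2 / n) / s powr (2 + 2 / n))" for R Rb s
  have weight: "weight N 2 R Rb t = W R Rb (?B R Rb - t)" for R Rb t
  proof -
    have "2 * (real N - 1) / (real N - 2) = 2 + 2 / n"
      using n by (simp add: n_def field_simps)
    thus ?thesis
      using N n by (simp add: weight_def W_def powr_numeral flip: n_def)
  qed
  let ?l = "\<lambda>R. (R * ((R + 1) powr n - R powr n) / (n * (R + 1) powr n))\<^sup>2"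
  let ?u = "\<lambda>R. ((R + 1) * ((R + 1) powr n - R powr n) / (n * R powr n))\<^sup>2"
  have B: "?B R (R + 1) = (R + 1) powr n / ((R + 1) powr n - R powr n)"
    "?B R (R + 1) - 1 = R powr n / ((R + 1) powr n - R powr n)"
    "?B R (R + 1) > 1" if "R > 0" for R
  proof -
    have "R powr n < (R + 1) powr n" using that n by (intro powr_less_mono2) auto
    thus "?B R (R + 1) = (R + 1) powr n / ((R + 1) powr n - R powr n)"
      "?B R (R + 1) - 1 = R powr n / ((R + 1) powr n - R powr n)" "?B R (R + 1) > 1"
      using that n by (auto simp: B_const_def n_def [symmetric] field_simps)
  qed
  have W_mono: "W R Rb s \<le> W R Rb s'" if "0 < s'" "s' \<le> s" for R Rb s s'
    unfolding W_def using that n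
    by (intro mult_left_mono divide_left_mono powr_mono2 mult_pos_pos) (auto simp: powr_ge_zero)
  \<comment> \<open>The choice \<open>z = R + 1\<close> gives the value at \<open>t = 0\<close> and
    \<open>z = R\<close> that at \<open>t = 1\<close>; the powers of the difference with exponent
    \<open>2 / n\<close> cancel.\<close>
  have W_end: "W R (R + 1) (z powr n / ((R + 1) powr n - R powr n)) =
      (R * (R + 1) / z * ((R + 1) powr n - R powr n) / (n * z powr n))\<^sup>2" if "R > 0" "z > 0" for R z
  proof -
    define D where "D = (R + 1) powr n - R powr n"
    have D: "D > 0" unfolding D_def using that n powr_less_mono2 [of n R "R + 1"] by simp
    have "?A R (R + 1) = (R * (R + 1)) powr n / D"
      by (simp add: A_const_def D_def n_def)
    hence A: "?A R (R + 1) powr (2 / n) = (R * (R + 1))\<^sup>2 / D powr (2 / n)"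
      using that n D by (simp add: powr_divide powr_powr powr_numeral)
    have "(z powr n / D) powr (2 + 2 / n) = z powr (n * (2 + 2 / n)) / D powr (2 + 2 / n)"
      using that D by (simp add: powr_divide powr_powr)
    also have "n * (2 + 2 / n) = n + n + 2" using n by (simp add: field_simps)
    also have "z powr (n + n + 2) = (z powr n)\<^sup>2 * z\<^sup>2"
      unfolding powr_add using that by (simp add: powr_numeral power2_eq_square)
    also have "D powr (2 + 2 / n) = D\<^sup>2 * D powr (2 / n)"
      using D by (simp add: powr_add powr_numeral)
    finally have "W R (R + 1) (z powr n / D) =
        (1 / n)\<^sup>2 * ((R * (R + 1))\<^sup>2 / D powr (2 / n) / ((z powr n)\<^sup>2 * z\<^sup>2 / (D\<^sup>2 * D powr (2 / n))))"
      by (simp add: W_def A)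
    also have "\<dots> = (R * (R + 1) / z * D / (n * z powr n))\<^sup>2"
    proof -
      have "(1 / n)\<^sup>2 * (Q\<^sup>2 / e / (x\<^sup>2 * z\<^sup>2 / (D\<^sup>2 * e))) = (Q / z * D / (n * x))\<^sup>2"
        if "e > 0" for Q e x :: real
        using that by (simp add: power_divide power_mult_distrib)
      thus ?thesis using D by simp
    qed
    finally show ?thesis by (simp add: D_def)
  qed
  have cont: "\<forall>\<^sub>F R in at_top. continuous_on {0..1} (weight N 2 R (R + 1))"
    using eventually_gt_at_top [of 0]
  proof eventually_elim
    case (elim R)
    have "continuous_on {0..1} (\<lambda>t. W R (R + 1) (?B R (R + 1) - t))"
      unfolding W_def using B(3) [OF elim] by (intro continuous_intros) auto
    thus ?case by (simp add: weight [abs_def])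
  qed
  have bounds: "\<forall>\<^sub>F R in at_top. \<forall>t\<in>{0..1}. ?l R \<le> weight N 2 R (R + 1) t \<and> weight N 2 R (R + 1) t \<le> ?u R"
    using eventually_gt_at_top [of 0]
  proof eventually_elim
    case (elim R)
    have "?l R = W R (R + 1) (?B R (R + 1))" "?u R = W R (R + 1) (?B R (R + 1) - 1)"
      unfolding B(2) [OF elim] unfolding B(1) [OF elim] using W_end [OF elim, of R] W_end [OF elim, of "R + 1"] elim by simp_all
    thus ?case
      unfolding weight using B(3) [OF elim] by (auto intro!: W_mono)
  qed
  have "((\<lambda>R. R * ((R + 1) powr n - R powr n) / (n * (R + 1) powr n)) \<longlongrightarrow> 1) at_top"
    using n by real_asymp
  moreover have "((\<lambda>R. (R + 1) * ((R + 1) powr n - R powr n) / (n * R powr n)) \<longlongrightarrow> 1) at_top"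
    using n by real_asymp
  ultimately have "(?l \<longlongrightarrow> 1\<^sup>2) at_top" "(?u \<longlongrightarrow> 1\<^sup>2) at_top"
    by (intro tendsto_power; simp)+
  hence lu: "(?l \<longlongrightarrow> 1) at_top" "(?u \<longlongrightarrow> 1) at_top" by simp_all
  show "((\<lambda>R. qbar_plus N 2 R (R + 1)) \<longlongrightarrow> 1) at_top"
    "((\<lambda>R. qbar_minus N 2 R (R + 1)) \<longlongrightarrow> 1) at_top"
    by (rule qbar_tendsto_1 [OF cont bounds lu])+
qed

theorem theorem1p2:
  fixes N :: nat and p :: real
  assumes "CARD('n::finite) = N" and "1 < p" and "p \<le> real N"
  shows
    "(real N = p \<longrightarrow>
        ((\<lambda>R. qbar_plus N p R (R + 1)) \<longlongrightarrow> 1) at_top \<and>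
        ((\<lambda>R. qbar_minus N p R (R + 1)) \<longlongrightarrow> 1) at_top \<and>
        (\<forall>k\<ge>1.
           ((\<lambda>R. radial_eigenvalue TYPE('n) p R (R + 1) k)
              \<longlongrightarrow> (real k * pi_p p) powr p) at_top \<and>
           kth_smallest (p_interval_eigenvalues p) k = (real k * pi_p p) powr p)) \<and>
     (p = 2 \<and> N \<ge> 3 \<longrightarrow>
        ((\<lambda>R. qbar_plus N p R (R + 1)) \<longlongrightarrow> 1) at_top \<and>
        ((\<lambda>R. qbar_minus N p R (R + 1)) \<longlongrightarrow> 1) at_top \<and>
        (\<forall>k\<ge>1.
           ((\<lambda>R. radial_eigenvalue TYPE('n) p R (R + 1) k)
              \<longlongrightarrow> (real k * pi)\<^sup>2) at_top \<and>
           kth_smallest interval_eigenvalues k = (real k * pi)\<^sup>2))"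
proof (intro conjI impI allI)
  assume N: "real N = p"
  show "((\<lambda>R. qbar_plus N p R (R + 1)) \<longlongrightarrow> 1) at_top"
    "((\<lambda>R. qbar_minus N p R (R + 1)) \<longlongrightarrow> 1) at_top"
    by (rule qbar_tendsto_1_conformal [OF assms(2) N])+
  fix k :: nat assume k: "k \<ge> 1"
  show "((\<lambda>R. radial_eigenvalue TYPE('n) p R (R + 1) k) \<longlongrightarrow> (real k * pi_p p) powr p) at_top"
    by (rule radial_eigenvalue_tendsto [OF assms(2) k])
  show "kth_smallest (p_interval_eigenvalues p) k = (real k * pi_p p) powr p"
    by (rule kth_p_interval_eigenvalue [OF assms(2) k])
next
  assume pN: "p = 2 \<and> N \<ge> 3"
  hence N: "N \<ge> 3" by simp
  show "((\<lambda>R. qbar_plus N p R (R + 1)) \<longlongrightarrow> 1) at_top"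
    "((\<lambda>R. qbar_minus N p R (R + 1)) \<longlongrightarrow> 1) at_top"
    using qbar_tendsto_1_laplacian [OF N] pN by simp_all
  fix k :: nat assume k: "k \<ge> 1"
  have eq: "(real k * pi_p 2) powr 2 = (real k * pi)\<^sup>2"
    using k by (simp add: pi_p_2 powr_numeral)
  show "((\<lambda>R. radial_eigenvalue TYPE('n) p R (R + 1) k) \<longlongrightarrow> (real k * pi)\<^sup>2) at_top"
    using radial_eigenvalue_tendsto [OF assms(2) k, where 'n = 'n] pN by (simp add: eq)
  show "kth_smallest interval_eigenvalues k = (real k * pi)\<^sup>2"
    using kth_p_interval_eigenvalue [of 2 k] k by (simp add: eq interval_eigenvalues_eq)
qed

end
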